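(* Let $\mathcal{H}$ be a finite-dimensional complex Hilbert space and let $\{F_j\}$ be an operator basis on $\mathcal{H}$. Then $\{F_j\}$ is supersymmetric if and only if its symmetry group is a unitary $2$-design.
   Context: Let $d=\dim\mathcal{H}$. An operator basis on $\mathcal{H}$ is a set of $d^2$ linear operators on $\mathcal{H}$ that form a basis of the space of all linear operators on $\mathcal{H}$ (no Hermiticity or orthogonality is required). The symmetry group $\overline{G}$ of $\{F_j\}$ consists of all unitary operators $U$ on $\mathcal{H}$ that leave the set invariant under conjugation, i.e. $UF_jU^\dagger=F_{\sigma(j)}$ for all $j$ and some permutation $\sigma$ (equality of operators, not just up to phase). Unitary operators that differ only by an overall phase factor are identified. The group $\overline{G}$ acts faithfully on the basis elements by conjugation, hence is finite. The basis is supersymmetric if $\overline{G}$ acts doubly transitively on its elements: any ordered pair of distinct basis elements can be mapped to any other ordered pair of distinct basis elements by some element of $\overline{G}$. A finite set of $K$ unitary operators $\{U_k\}$ on $\mathcal{H}$ is a unitary $2$-design if for every operator $M$ on $\mathcal{H}\otimes\mathcal{H}$, $$\frac1K\sum_k U_k^{\otimes 2}M(U_k^{\otimes 2})^\dagger=\int dU\,U^{\otimes 2}M(U^{\otimes 2})^\dagger,$$ where the integral is over the whole unitary group of $\mathcal{H}$ with respect to normalized Haar measure. The condition is insensitive to phases, so it makes sense for a finite group of unitaries modulo phases (choose one representative for each element). *)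

theory Defs
  imports "HOL-Probability.Probability"
begin

text \<open>
  A complex Hilbert space of finite dimension \<open>d = CARD('n)\<close> is represented, after a choice of an
  orthonormal basis, by \<^typ>\<open>complex^'n\<close>; operators on it are the matrices of type
  \<^typ>\<open>complex^'n^'n\<close>.
\<close>

section \<open>Operators and operator bases\<close>

definition cscale :: "complex \<Rightarrow> complex^'n^'m \<Rightarrow> complex^'n^'m" where
  "cscale c A = (\<chi> i j. c * A $ i $ j)"

text \<open>
  The class-based \<^const>\<open>span\<close> and \<^const>\<open>independent\<close> refer to real scalars, so the complex vector
  space of operators is obtained by interpretation.
\<close>

global_interpretation cmat: vector_space "cscale :: complex \<Rightarrow> complex^'n^'m \<Rightarrow> complex^'n^'m"
  by standard (auto simp: cscale_def vec_eq_iff algebra_simps)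

definition adjoint_mat :: "complex^'n^'m \<Rightarrow> complex^'m^'n" where
  "adjoint_mat A = (\<chi> i j. cnj (A $ j $ i))"

definition unitaries :: "(complex^'n^'n) set" where
  "unitaries = {U. adjoint_mat U ** U = mat 1 \<and> U ** adjoint_mat U = mat 1}"

definition conjugate_by :: "complex^'n^'n \<Rightarrow> complex^'n^'n \<Rightarrow> complex^'n^'n" where
  "conjugate_by U A = U ** A ** adjoint_mat U"

definition operator_basis :: "(complex^'n^'n) set \<Rightarrow> bool" where
  "operator_basis B \<longleftrightarrow>
     finite B \<and> card B = CARD('n)\<^sup>2 \<and> cmat.independent B \<and> cmat.span B = UNIV"


section \<open>The symmetry group and supersymmetry\<close>

text \<open>Elements of the symmetry group are classes of unitaries modulo an overall phase.\<close>

definition phase_class :: "complex^'n^'n \<Rightarrow> (complex^'n^'n) set" where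
  "phase_class U = {cscale c U |c. cmod c = 1}"

definition symmetry_group :: "(complex^'n^'n) set \<Rightarrow> (complex^'n^'n) set set" where
  "symmetry_group B = phase_class ` {U \<in> unitaries. conjugate_by U ` B = B}"

text \<open>
  Conjugation by \<open>U\<close> does not depend on the phase of \<open>U\<close>, so it does not matter which member of the
  class \<open>g\<close> represents the action of \<open>g\<close>.
\<close>

definition supersymmetric :: "(complex^'n^'n) set \<Rightarrow> bool" where
  "supersymmetric B \<longleftrightarrow>
     (\<forall>E\<in>B. \<forall>F\<in>B. \<forall>E'\<in>B. \<forall>F'\<in>B. E \<noteq> F \<longrightarrow> E' \<noteq> F' \<longrightarrow>
        (\<exists>g\<in>symmetry_group B. \<forall>U\<in>g. conjugate_by U E = E' \<and> conjugate_by U F = F'))"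


section \<open>Normalized Haar measure on the unitary group\<close>

definition is_haar_unitary :: "(complex^'n^'n) measure \<Rightarrow> bool" where
  "is_haar_unitary \<mu> \<longleftrightarrow>
     sets \<mu> = sets (restrict_space borel unitaries) \<and> prob_space \<mu> \<and>
     (\<forall>V\<in>unitaries. distr \<mu> \<mu> (\<lambda>U. V ** U) = \<mu>)"

text \<open>
  Existence and uniqueness are proved at the end of this theory
  (\<open>is_haar_unitary_haar_unitary\<close> and \<open>is_haar_unitary_unique\<close>); right invariance is a consequence
  (\<open>haar_unitary_right_invariant\<close>).
\<close>

definition haar_unitary :: "(complex^'n^'n) measure" where
  "haar_unitary = (THE \<mu>. is_haar_unitary \<mu>)"


section \<open>Unitary 2-designs\<close>

text \<open>Operators on the tensor square are matrices indexed by pairs.\<close>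

definition kron :: "complex^'n^'n \<Rightarrow> complex^'n^'n \<Rightarrow> complex^('n \<times> 'n)^('n \<times> 'n)" where
  "kron A B = (\<chi> p q. A $ fst p $ fst q * B $ snd p $ snd q)"

definition unitary_2_design :: "(complex^'n^'n) set \<Rightarrow> bool" where
  "unitary_2_design S \<longleftrightarrow> finite S \<and> S \<subseteq> unitaries \<and>
     (\<forall>M :: complex^('n \<times> 'n)^('n \<times> 'n).
        cscale (1 / of_nat (card S)) (\<Sum>U\<in>S. conjugate_by (kron U U) M) =
        (\<integral>U. conjugate_by (kron U U) M \<partial>haar_unitary))"

text \<open>For a set of phase classes, one representative is chosen from each class.\<close>

definition projective_unitary_2_design :: "(complex^'n^'n) set set \<Rightarrow> bool" where
  "projective_unitary_2_design G \<longleftrightarrow>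
     (\<forall>rep. (\<forall>g\<in>G. rep g \<in> g) \<longrightarrow> unitary_2_design (rep ` G))"


section \<open>Existence and uniqueness of the Haar measure\<close>

lemma adjoint_mat_mult: "adjoint_mat (A ** B) = adjoint_mat B ** adjoint_mat A"
  by (simp add: adjoint_mat_def matrix_matrix_mult_def vec_eq_iff mult.commute)

lemma adjoint_mat_adjoint [simp]: "adjoint_mat (adjoint_mat A) = A"
  by (simp add: adjoint_mat_def vec_eq_iff)

lemma adjoint_mat_one [simp]: "adjoint_mat (mat 1) = mat 1"
  by (simp add: adjoint_mat_def mat_def vec_eq_iff)

lemma unitariesI: "adjoint_mat U ** U = mat 1 \<Longrightarrow> U \<in> unitaries"
  using matrix_left_right_inverse by (auto simp: unitaries_def)

lemma unitaries_one: "mat 1 \<in> unitaries"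
  by (simp add: unitaries_def)

lemma unitaries_adjoint: "U \<in> unitaries \<Longrightarrow> adjoint_mat U \<in> unitaries"
  by (simp add: unitaries_def)

lemma unitaries_mult:
  assumes "U \<in> unitaries" "V \<in> unitaries"
  shows "U ** V \<in> unitaries"
proof (rule unitariesI)
  have "adjoint_mat (U ** V) ** (U ** V) = adjoint_mat V ** (adjoint_mat U ** U) ** V"
    by (simp add: adjoint_mat_mult matrix_mul_assoc)
  then show "adjoint_mat (U ** V) ** (U ** V) = mat 1"
    using assms by (simp add: unitaries_def)
qed

lemma continuous_on_matrix_mult [continuous_intros]:
  fixes f :: "'a::topological_space \<Rightarrow> complex^'n^'m" and g :: "'a \<Rightarrow> complex^'k^'n"
  assumes "continuous_on S f" "continuous_on S g"
  shows "continuous_on S (\<lambda>x. f x ** g x)"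
  unfolding matrix_matrix_mult_def by (intro continuous_intros assms)

lemma continuous_on_adjoint_mat [continuous_intros]:
  fixes f :: "'a::topological_space \<Rightarrow> complex^'n^'m"
  assumes "continuous_on S f"
  shows "continuous_on S (\<lambda>x. adjoint_mat (f x))"
  unfolding adjoint_mat_def by (intro continuous_intros assms)

lemma closed_unitaries: "closed (unitaries :: (complex^'n^'n) set)"
  unfolding unitaries_def
  by (intro closed_Collect_conj closed_Collect_eq continuous_intros)

lemma sets_unitaries [measurable]: "unitaries \<in> sets borel"
  by (simp add: closed_unitaries)

abbreviation unitary_borel :: "(complex^'n^'n) measure" where
  "unitary_borel \<equiv> restrict_space borel unitaries"

lemma space_unitary_borel: "space unitary_borel = unitaries"
  by (simp add: space_restrict_space)

lemma measurable_unitary_mult_pair: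
  "(\<lambda>(U, V). U ** V) \<in> unitary_borel \<Otimes>\<^sub>M unitary_borel \<rightarrow>\<^sub>M unitary_borel"
proof (rule measurable_restrict_space2)
  show "(\<lambda>(U, V). U ** V) \<in> space (unitary_borel \<Otimes>\<^sub>M unitary_borel) \<rightarrow> unitaries"
    by (auto simp: space_pair_measure space_unitary_borel unitaries_mult)
  have "(\<lambda>p. fst p ** snd p) \<in> borel_measurable
      (borel :: ((complex^'a^'a) \<times> (complex^'a^'a)) measure)"
    by (intro borel_measurable_continuous_onI continuous_intros)
  then have m: "(\<lambda>p. fst p ** snd p) \<in>
      (borel \<Otimes>\<^sub>M borel :: ((complex^'a^'a) \<times> (complex^'a^'a)) measure) \<rightarrow>\<^sub>M borel"
    by (simp add: borel_prod)
  have "fst \<in> (unitary_borel \<Otimes>\<^sub>M unitary_borel :: ((complex^'a^'a) \<times> (complex^'a^'a)) measure) \<rightarrow>\<^sub>M borel"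
    "snd \<in> (unitary_borel \<Otimes>\<^sub>M unitary_borel :: ((complex^'a^'a) \<times> (complex^'a^'a)) measure) \<rightarrow>\<^sub>M borel"
    by (rule measurable_compose[OF measurable_fst], simp add: measurable_restrict_space1)
       (rule measurable_compose[OF measurable_snd], simp add: measurable_restrict_space1)
  from measurable_compose[OF measurable_Pair[OF this] m]
  show "(\<lambda>(U, V). U ** V) \<in> borel_measurable (unitary_borel \<Otimes>\<^sub>M unitary_borel
      :: ((complex^'a^'a) \<times> (complex^'a^'a)) measure)"
    by (simp add: case_prod_beta)
qed

lemma measurable_unitary_mult:
  assumes "f \<in> M \<rightarrow>\<^sub>M unitary_borel" "g \<in> M \<rightarrow>\<^sub>M unitary_borel"
  shows "(\<lambda>x. f x ** g x) \<in> M \<rightarrow>\<^sub>M unitary_borel"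
  using measurable_compose[OF measurable_Pair[OF assms] measurable_unitary_mult_pair] by simp

lemma measurable_unitary_adjoint: "adjoint_mat \<in> unitary_borel \<rightarrow>\<^sub>M unitary_borel"
proof (rule measurable_restrict_space2)
  show "adjoint_mat \<in> space unitary_borel \<rightarrow> unitaries"
    by (auto simp: space_unitary_borel unitaries_adjoint)
  have "(\<lambda>A :: complex^'a^'a. adjoint_mat A) \<in> borel_measurable borel"
    by (intro borel_measurable_continuous_onI continuous_intros)
  then show "adjoint_mat \<in> borel_measurable (unitary_borel :: (complex^'a^'a) measure)"
    by (rule measurable_restrict_space1)
qed

lemma haar_nn_integral_left:
  assumes "is_haar_unitary \<mu>" "V \<in> unitaries" "f \<in> borel_measurable unitary_borel"
  shows "(\<integral>\<^sup>+U. f (V ** U) \<partial>\<mu>) = (\<integral>\<^sup>+U. f U \<partial>\<mu>)"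
proof -
  have s: "sets \<mu> = sets unitary_borel" and d: "distr \<mu> \<mu> (\<lambda>U. V ** U) = \<mu>"
    using assms by (auto simp: is_haar_unitary_def)
  have "(\<lambda>U. V ** U) \<in> unitary_borel \<rightarrow>\<^sub>M unitary_borel"
    using assms(2) by (intro measurable_unitary_mult) (auto simp: space_unitary_borel)
  then have m: "(\<lambda>U. V ** U) \<in> \<mu> \<rightarrow>\<^sub>M \<mu>"
    by (simp add: measurable_cong_sets[OF s s])
  have "(\<integral>\<^sup>+U. f U \<partial>distr \<mu> \<mu> (\<lambda>U. V ** U)) = (\<integral>\<^sup>+U. f (V ** U) \<partial>\<mu>)"
    using assms(3) m by (intro nn_integral_distr) (simp_all add: measurable_cong_sets[OF s refl])
  then show ?thesis by (simp add: d)
qed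

lemma haar_nn_integral_adjoint:
  assumes \<mu>: "is_haar_unitary \<mu>" and \<nu>: "is_haar_unitary \<nu>"
    and f: "f \<in> borel_measurable unitary_borel"
  shows "(\<integral>\<^sup>+U. f (adjoint_mat U) \<partial>\<nu>) = (\<integral>\<^sup>+U. f U \<partial>\<mu>)"
proof -
  have s: "sets \<mu> = sets unitary_borel" "sets \<nu> = sets unitary_borel"
    using \<mu> \<nu> by (auto simp: is_haar_unitary_def)
  then have sp: "space \<mu> = unitaries" "space \<nu> = unitaries"
    using sets_eq_imp_space_eq space_unitary_borel by metis+
  interpret M: prob_space \<mu> using \<mu> by (simp add: is_haar_unitary_def)
  interpret N: prob_space \<nu> using \<nu> by (simp add: is_haar_unitary_def)
  interpret P: pair_sigma_finite \<mu> \<nu> by unfold_locales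
  have "(\<lambda>(U, V). f (adjoint_mat V ** U)) \<in> borel_measurable (unitary_borel \<Otimes>\<^sub>M unitary_borel)"
    unfolding case_prod_beta
    by (intro measurable_compose[OF _ f] measurable_unitary_mult
        measurable_compose[OF measurable_snd measurable_unitary_adjoint] measurable_fst)
  then have m: "(\<lambda>(U, V). f (adjoint_mat V ** U)) \<in> borel_measurable (\<mu> \<Otimes>\<^sub>M \<nu>)"
    by (simp cong: measurable_cong_sets add: sets_pair_measure_cong[OF s]
          measurable_cong_sets[OF sets_pair_measure_cong[OF s] refl])
  have f': "(\<lambda>U. f (adjoint_mat U)) \<in> borel_measurable unitary_borel"
    by (rule measurable_compose[OF measurable_unitary_adjoint f])
  have "(\<integral>\<^sup>+V. \<integral>\<^sup>+U. f (adjoint_mat V ** U) \<partial>\<mu> \<partial>\<nu>) = (\<integral>\<^sup>+V. \<integral>\<^sup>+U. f U \<partial>\<mu> \<partial>\<nu>)"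
    by (intro nn_integral_cong haar_nn_integral_left[OF \<mu> _ f])
       (simp add: sp unitaries_adjoint)
  also have "\<dots> = (\<integral>\<^sup>+U. f U \<partial>\<mu>)"
    by (simp add: N.emeasure_space_1)
  finally have 1: "(\<integral>\<^sup>+V. \<integral>\<^sup>+U. f (adjoint_mat V ** U) \<partial>\<mu> \<partial>\<nu>) = (\<integral>\<^sup>+U. f U \<partial>\<mu>)" .
  have "(\<integral>\<^sup>+U. \<integral>\<^sup>+V. f (adjoint_mat V ** U) \<partial>\<nu> \<partial>\<mu>) =
      (\<integral>\<^sup>+U. \<integral>\<^sup>+V. f (adjoint_mat (adjoint_mat U ** V)) \<partial>\<nu> \<partial>\<mu>)"
    by (simp add: adjoint_mat_mult)
  also have "\<dots> = (\<integral>\<^sup>+U. \<integral>\<^sup>+V. f (adjoint_mat V) \<partial>\<nu> \<partial>\<mu>)"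
    by (intro nn_integral_cong haar_nn_integral_left[OF \<nu> _ f'])
       (simp add: sp unitaries_adjoint)
  also have "\<dots> = (\<integral>\<^sup>+V. f (adjoint_mat V) \<partial>\<nu>)"
    by (simp add: M.emeasure_space_1)
  finally show ?thesis
    using 1 P.Fubini[OF m] by simp
qed

lemma is_haar_unitary_eqI:
  assumes "sets \<mu> = sets unitary_borel" "sets \<nu> = sets unitary_borel"
    and "\<And>f. f \<in> borel_measurable unitary_borel \<Longrightarrow> (\<integral>\<^sup>+U. f U \<partial>\<mu>) = (\<integral>\<^sup>+U. f U \<partial>\<nu>)"
  shows "\<mu> = \<nu>"
proof (rule measure_eqI)
  fix A assume A: "A \<in> sets \<mu>"
  then have "(\<integral>\<^sup>+U. indicator A U \<partial>\<mu>) = (\<integral>\<^sup>+U. indicator A U \<partial>\<nu>)"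
    using assms by (intro assms(3)) auto
  moreover have "A \<in> sets \<nu>" using A assms by simp
  ultimately show "emeasure \<mu> A = emeasure \<nu> A"
    using A by (simp only: nn_integral_indicator)
qed (use assms in simp)

lemma is_haar_unitary_unique:
  assumes \<mu>: "is_haar_unitary \<mu>" and \<nu>: "is_haar_unitary \<nu>"
  shows "\<mu> = \<nu>"
proof (rule is_haar_unitary_eqI)
  fix f :: "complex^'a^'a \<Rightarrow> ennreal" assume f: "f \<in> borel_measurable unitary_borel"
  show "(\<integral>\<^sup>+U. f U \<partial>\<mu>) = (\<integral>\<^sup>+U. f U \<partial>\<nu>)"
    using haar_nn_integral_adjoint[OF \<mu> \<nu> f] haar_nn_integral_adjoint[OF \<nu> \<nu> f] by simp
qed (use assms in \<open>auto simp: is_haar_unitary_def\<close>)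

text \<open>
  For existence, the normalized Lebesgue measure on the invertible matrices in a ball is pushed
  forward by the unitary factor of the Gram-Schmidt decomposition, a map that commutes with left
  multiplication by unitaries.
\<close>

lemma lborel_eq_translation_invariant:
  fixes \<nu> :: "'a::euclidean_space measure"
  assumes sets: "sets \<nu> = sets borel" and sf: "sigma_finite_measure \<nu>"
    and inv: "\<And>c. distr \<nu> borel ((+) c) = \<nu>"
    and ball: "emeasure \<nu> (ball 0 1) = emeasure lborel (ball (0::'a) 1)"
  shows "\<nu> = lborel"
proof (rule measure_eqI)
  fix A assume "A \<in> sets \<nu>"
  then have A [measurable]: "A \<in> sets borel" by (simp add: sets)
  interpret N: sigma_finite_measure \<nu> by fact
  interpret P: pair_sigma_finite lborel \<nu> by unfold_locales
  note [measurable_cong] = sets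
  let ?b = "emeasure lborel (ball (0::'a) 1)"
  define g :: "'a \<Rightarrow> ennreal" where "g = indicator (ball 0 1)"
  define f :: "'a \<Rightarrow> ennreal" where "f = indicator A"
  have [measurable]: "g \<in> borel_measurable borel" "f \<in> borel_measurable borel"
    unfolding f_def g_def by (rule borel_measurable_indicator, simp add: A)+
  have g_minus: "g (- x) = g x" for x by (simp add: g_def indicator_def)
  have shift_l: "(\<integral>\<^sup>+y. h (c + y) \<partial>lborel) = (\<integral>\<^sup>+y. h y \<partial>lborel)"
    if [measurable]: "h \<in> borel_measurable borel" for h and c :: 'a
    by (subst (2) lborel_distr_plus[symmetric, of c]) (simp add: nn_integral_distr)
  have shift_n: "(\<integral>\<^sup>+y. h (c + y) \<partial>\<nu>) = (\<integral>\<^sup>+y. h y \<partial>\<nu>)"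
    if [measurable]: "h \<in> borel_measurable borel" for h and c :: 'a
    by (subst (2) inv[symmetric, of c]) (simp add: nn_integral_distr)
  have gl: "(\<integral>\<^sup>+y. g y \<partial>lborel) = ?b" and gn: "(\<integral>\<^sup>+y. g y \<partial>\<nu>) = ?b"
    and fl: "(\<integral>\<^sup>+y. f y \<partial>lborel) = emeasure lborel A" and fn: "(\<integral>\<^sup>+y. f y \<partial>\<nu>) = emeasure \<nu> A"
    by (simp_all add: g_def f_def sets ball)
  have "emeasure \<nu> A * ?b = (\<integral>\<^sup>+x. \<integral>\<^sup>+y. f x * g y \<partial>lborel \<partial>\<nu>)"
    by (simp add: nn_integral_cmult nn_integral_multc gl fn)
  also have "\<dots> = (\<integral>\<^sup>+x. \<integral>\<^sup>+y. f x * g (- x + y) \<partial>lborel \<partial>\<nu>)"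
  proof (rule nn_integral_cong)
    fix x show "(\<integral>\<^sup>+y. f x * g y \<partial>lborel) = (\<integral>\<^sup>+y. f x * g (- x + y) \<partial>lborel)"
      by (rule shift_l[of "\<lambda>y. f x * g y" "- x", symmetric]) measurable
  qed
  also have "\<dots> = (\<integral>\<^sup>+y. \<integral>\<^sup>+x. f x * g (- x + y) \<partial>\<nu> \<partial>lborel)"
    using P.Fubini[of "\<lambda>(y, x). f x * g (- x + y)"] by simp
  also have "\<dots> = (\<integral>\<^sup>+y. \<integral>\<^sup>+x. f (y + x) * g x \<partial>\<nu> \<partial>lborel)"
  proof (rule nn_integral_cong)
    fix y
    have "(\<integral>\<^sup>+x. f x * g (- x + y) \<partial>\<nu>) = (\<integral>\<^sup>+x. f (y + x) * g (- (y + x) + y) \<partial>\<nu>)"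
      by (rule shift_n[of "\<lambda>x. f x * g (- x + y)" y, symmetric]) measurable
    then show "(\<integral>\<^sup>+x. f x * g (- x + y) \<partial>\<nu>) = (\<integral>\<^sup>+x. f (y + x) * g x \<partial>\<nu>)"
      by (simp add: g_minus)
  qed
  also have "\<dots> = (\<integral>\<^sup>+x. \<integral>\<^sup>+y. f (y + x) * g x \<partial>lborel \<partial>\<nu>)"
    using P.Fubini[of "\<lambda>(y, x). f (y + x) * g x"] by simp
  also have "\<dots> = (\<integral>\<^sup>+x. emeasure lborel A * g x \<partial>\<nu>)"
  proof (rule nn_integral_cong)
    fix x
    show "(\<integral>\<^sup>+y. f (y + x) * g x \<partial>lborel) = emeasure lborel A * g x"
      using shift_l[of f x] by (simp add: nn_integral_multc fl add.commute)
  qed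
  also have "\<dots> = emeasure lborel A * ?b"
    by (simp add: nn_integral_cmult gn)
  finally have eq: "emeasure \<nu> A * ?b = emeasure lborel A * ?b" .
  have "?b \<noteq> 0"
    using open_not_negligible[of "ball (0::'a) 1"]
    by (auto simp: negligible_iff_null_sets null_sets_completion_iff intro: null_sets_completionI)
  moreover have "?b \<noteq> \<top>"
    using emeasure_lborel_ball_finite[of "0::'a" 1] by simp
  ultimately show "emeasure \<nu> A = emeasure lborel A"
    using eq by (simp add: mult.commute[of _ ?b] ennreal_mult_cancel_left)
qed (simp add: sets)

lemma lborel_distr_linear_isometry:
  fixes L :: "'a::euclidean_space \<Rightarrow> 'a"
  assumes lin: "linear L" and iso: "\<And>x. norm (L x) = norm x"
  shows "distr lborel borel L = lborel"
proof (rule lborel_eq_translation_invariant)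
  have inj: "inj L"
    using linear_injective_0[OF lin] iso by (metis norm_eq_zero)
  then have surj: "surj L"
    using linear_injective_imp_surjective lin by blast
  have [measurable]: "L \<in> borel_measurable borel"
    by (intro borel_measurable_continuous_onI linear_continuous_on) (simp add: lin linear_conv_bounded_linear[symmetric])
  show "emeasure (distr lborel borel L) (ball 0 1) = emeasure lborel (ball (0::'a) 1)"
  proof -
    have "L -` ball 0 1 = ball 0 1" by (auto simp: iso)
    then show ?thesis by (simp add: emeasure_distr)
  qed
  show "sigma_finite_measure (distr lborel borel L)"
  proof (rule sigma_finite_measure.intro, intro exI[of _ "range (\<lambda>n. ball (0::'a) (real n))"] conjI ballI)
    show "\<Union>(range (\<lambda>n. ball 0 (real n))) = space (distr lborel borel L)"
      by (auto simp: reals_Archimedean2)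
    fix a assume "a \<in> range (\<lambda>n. ball (0::'a) (real n))"
    then obtain n where a: "a = ball 0 (real n)" by auto
    have "L -` ball 0 (real n) = ball 0 (real n)" by (auto simp: iso)
    then show "emeasure (distr lborel borel L) a \<noteq> \<infinity>"
      using emeasure_lborel_ball_finite[of "0::'a" "real n"] by (simp add: a emeasure_distr)
  qed auto
  fix c :: 'a
  obtain b where b: "c = L b" using surj by auto
  have "distr (distr lborel borel L) borel ((+) c) = distr lborel borel (\<lambda>x. c + L x)"
    by (subst distr_distr) (auto simp: o_def)
  also have "\<dots> = distr lborel borel (L \<circ> (+) b)"
    by (simp add: o_def b linear_add[OF lin])
  also have "\<dots> = distr (distr lborel borel ((+) b)) borel L"
    by (subst distr_distr) auto
  finally show "distr (distr lborel borel L) borel ((+) c) = distr lborel borel L"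
    by (simp add: lborel_distr_plus)
qed simp

definition cip :: "complex^'n \<Rightarrow> complex^'n \<Rightarrow> complex" where
  "cip x y = (\<Sum>i\<in>UNIV. cnj (x $ i) * y $ i)"

lemma cip_self: "cip x x = of_real ((norm x)\<^sup>2)"
proof -
  have "cip x x = (\<Sum>i\<in>UNIV. of_real ((cmod (x $ i))\<^sup>2))"
    unfolding cip_def
    by (simp add: mult.commute complex_norm_square[symmetric] del: of_real_power)
  also have "\<dots> = of_real ((norm x)\<^sup>2)"
    by (simp add: norm_vec_def L2_set_def sum_nonneg)
  finally show ?thesis .
qed

lemma cip_diff_right: "cip x (y - z) = cip x y - cip x z"
  by (simp add: cip_def algebra_simps sum_subtractf)

lemma cip_smult_right: "cip x (c *s y) = c * cip x y"
  by (simp add: cip_def sum_distrib_left algebra_simps)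

lemma cip_sum_right: "cip x (sum f S) = (\<Sum>j\<in>S. cip x (f j))"
  by (simp add: cip_def sum_distrib_left sum.swap[of _ S])

lemma cip_cnj: "cip y x = cnj (cip x y)"
  by (simp add: cip_def mult.commute)

lemma cip_unitary:
  assumes "V \<in> unitaries"
  shows "cip (V *v x) (V *v y) = cip x y"
proof -
  have *: "cip (V *v x) z = cip x (adjoint_mat V *v z)" for z
  proof -
    have "cip (V *v x) z = (\<Sum>i\<in>UNIV. \<Sum>j\<in>UNIV. cnj (V $ i $ j) * cnj (x $ j) * z $ i)"
      by (simp add: cip_def matrix_vector_mult_def sum_distrib_right)
    also have "\<dots> = (\<Sum>j\<in>UNIV. \<Sum>i\<in>UNIV. cnj (V $ i $ j) * cnj (x $ j) * z $ i)"
      by (rule sum.swap)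
    also have "\<dots> = cip x (adjoint_mat V *v z)"
      by (simp add: cip_def matrix_vector_mult_def adjoint_mat_def sum_distrib_left mult_ac)
    finally show ?thesis .
  qed
  show ?thesis
    using assms by (simp add: * matrix_vector_mul_assoc unitaries_def)
qed

lemma norm_unitary_mult_vec:
  assumes "V \<in> unitaries"
  shows "norm (V *v x) = norm x"
proof -
  have "complex_of_real ((norm (V *v x))\<^sup>2) = of_real ((norm x)\<^sup>2)"
    using cip_unitary[OF assms, of x x] by (simp only: cip_self)
  then show ?thesis by (simp only: of_real_eq_iff) simp
qed

lemma column_mult: "column j (A ** B) = A *v column j B"
  by (simp add: column_def matrix_matrix_mult_def matrix_vector_mult_def vec_eq_iff)

lemma norm_matrix_columns:
  fixes A :: "complex^'n^'n"
  shows "(norm A)\<^sup>2 = (\<Sum>j\<in>UNIV. (norm (column j A))\<^sup>2)"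
proof -
  have "(norm A)\<^sup>2 = (\<Sum>i\<in>UNIV. \<Sum>j\<in>UNIV. (cmod (A $ i $ j))\<^sup>2)"
    by (simp add: norm_vec_def L2_set_def sum_nonneg)
  also have "\<dots> = (\<Sum>j\<in>UNIV. \<Sum>i\<in>UNIV. (cmod (A $ i $ j))\<^sup>2)"
    by (rule sum.swap)
  also have "\<dots> = (\<Sum>j\<in>UNIV. (norm (column j A))\<^sup>2)"
    by (simp add: norm_vec_def L2_set_def sum_nonneg column_def)
  finally show ?thesis .
qed

lemma norm_unitary_mult:
  fixes A :: "complex^'n^'n"
  assumes "V \<in> unitaries"
  shows "norm (V ** A) = norm A"
proof -
  have "(norm (V ** A))\<^sup>2 = (norm A)\<^sup>2"
    by (simp add: norm_matrix_columns column_mult norm_unitary_mult_vec[OF assms])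
  then show ?thesis using power2_eq_imp_eq norm_ge_zero by blast
qed

fun gs_col :: "(nat \<Rightarrow> 'n) \<Rightarrow> complex^'n^'n \<Rightarrow> nat \<Rightarrow> complex^'n" where
  "gs_col e X k =
     (let r = column (e k) X - (\<Sum>j<k. cip (gs_col e X j) (column (e k) X) *s gs_col e X j)
      in (1 / norm r) *\<^sub>R r)"

declare gs_col.simps [simp del]

definition gs_res :: "(nat \<Rightarrow> 'n) \<Rightarrow> complex^'n^'n \<Rightarrow> nat \<Rightarrow> complex^'n" where
  "gs_res e X k = column (e k) X - (\<Sum>j<k. cip (gs_col e X j) (column (e k) X) *s gs_col e X j)"

lemma gs_col_eq: "gs_col e X k = (1 / norm (gs_res e X k)) *\<^sub>R gs_res e X k"
  by (subst gs_col.simps) (simp add: gs_res_def Let_def)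

lemma scaleR_eq_smult: "r *\<^sub>R (x :: complex^'n) = of_real r *s x"
  by (simp add: vec_eq_iff vector_scalar_mult_def scaleR_conv_of_real[where 'a = complex])

lemma matrix_vector_mult_sum: "A *v sum f S = (\<Sum>j\<in>S. A *v (f j :: complex^'n))"
  by (induction S rule: infinite_finite_induct) (auto simp: matrix_vector_right_distrib)

lemma gs_col_mult:
  assumes V: "V \<in> unitaries"
  shows "gs_col e (V ** X) k = V *v gs_col e X k"
proof (induction k rule: less_induct)
  case (less k)
  have "gs_res e (V ** X) k = V *v gs_res e X k"
    using less by (simp add: gs_res_def column_mult cip_unitary[OF V] matrix_vector_mult_diff_distrib
        matrix_vector_mult_sum vector_scalar_commute)
  then show ?case
    by (simp add: gs_col_eq norm_unitary_mult_vec[OF V] scaleR_eq_smult vector_scalar_commute)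
qed

lemma gs_col_norm: "gs_col e X k = 0 \<or> norm (gs_col e X k) = 1"
  by (auto simp: gs_col_eq)

lemma gs_col_orthogonal: "i < k \<Longrightarrow> cip (gs_col e X i) (gs_col e X k) = 0"
proof (induction k arbitrary: i rule: less_induct)
  case (less k)
  let ?q = "gs_col e X" and ?x = "column (e k) X"
  have orth: "cip (?q i) (?q j) = 0" if "j < k" "j \<noteq> i" for j
  proof (cases "i < j")
    case True
    then show ?thesis using less.IH[of j i] that by simp
  next
    case False
    then have "cip (?q j) (?q i) = 0" using less.IH[of i j] less.prems that by simp
    then show ?thesis using cip_cnj[of "?q i" "?q j"] by simp
  qed
  have "(\<Sum>j<k. cip (?q j) ?x * cip (?q i) (?q j)) =
      (\<Sum>j<k. if j = i then cip (?q i) ?x * cip (?q i) (?q i) else 0)"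
    by (intro sum.cong) (auto simp: orth)
  also have "\<dots> = cip (?q i) ?x * cip (?q i) (?q i)"
    using less.prems by simp
  also have "\<dots> = cip (?q i) ?x"
    using gs_col_norm[of e X i] by (auto simp: cip_self) (simp add: cip_def)
  finally have "cip (?q i) (gs_res e X k) = 0"
    by (simp add: gs_res_def cip_diff_right cip_sum_right cip_smult_right)
  then show ?case
    by (simp add: gs_col_eq[of e X k] scaleR_eq_smult cip_smult_right)
qed

definition enum :: "nat \<Rightarrow> 'n::finite" where
  "enum = (SOME e. bij_betw e {..<CARD('n)} UNIV)"

lemma enum: "bij_betw (enum :: nat \<Rightarrow> 'n::finite) {..<CARD('n)} UNIV"
proof -
  have "\<exists>e :: nat \<Rightarrow> 'n. bij_betw e {..<CARD('n)} UNIV"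
    using ex_bij_betw_nat_finite[of "UNIV :: 'n set"] by (simp add: lessThan_atLeast0)
  then show ?thesis unfolding enum_def by (rule someI_ex)
qed

definition index_of :: "'n::finite \<Rightarrow> nat" where
  "index_of = inv_into {..<CARD('n)} enum"

lemma enum_index_of [simp]: "enum (index_of i) = i"
  unfolding index_of_def by (rule bij_betw_inv_into_right[OF enum]) simp

lemma index_of_enum [simp]: "k < CARD('n) \<Longrightarrow> index_of (enum k :: 'n::finite) = k"
  unfolding index_of_def by (rule bij_betw_inv_into_left[OF enum]) simp

lemma index_of_less: "index_of (i :: 'n::finite) < CARD('n)"
  unfolding index_of_def using enum bij_betwE[OF bij_betw_inv_into[OF enum]] by blast

lemma index_of_eq_iff [simp]: "index_of i = index_of j \<longleftrightarrow> i = j"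
  by (metis enum_index_of)

definition gs_mat :: "complex^'n^'n \<Rightarrow> complex^'n^'n" where
  "gs_mat X = (\<chi> i j. gs_col enum X (index_of j) $ i)"

lemma column_gs_mat: "column j (gs_mat X) = gs_col enum X (index_of j)"
  by (simp add: column_def gs_mat_def vec_eq_iff)

lemma mult_axis_eq_column: "A *v axis j (1::complex) = column j A"
  by (simp add: vec_eq_iff matrix_vector_mult_def axis_def column_def if_distrib cong: if_cong)

lemma matrix_eq_columns: "(\<And>j. column j A = column j B) \<Longrightarrow> A = B"
  by (simp add: column_def vec_eq_iff)

lemma gs_mat_mult: "V \<in> unitaries \<Longrightarrow> gs_mat (V ** X) = V ** gs_mat X"
  by (rule matrix_eq_columns) (simp add: column_gs_mat column_mult gs_col_mult)

lemma gs_mat_factor: "\<exists>Y. X = gs_mat X ** Y"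
proof -
  define Y :: "complex^'a^'a" where
    "Y = (\<chi> i j. if index_of i < index_of j then cip (gs_col enum X (index_of i)) (column j X)
                 else if i = j then of_real (norm (gs_res enum X (index_of j))) else 0)"
  have "column j X = column j (gs_mat X ** Y)" for j
  proof -
    let ?k = "index_of j" and ?q = "gs_col enum X"
    have "column j (gs_mat X ** Y) = (\<Sum>i\<in>UNIV. Y $ i $ j *s ?q (index_of i))"
      by (simp add: vec_eq_iff column_def matrix_matrix_mult_def gs_mat_def mult.commute)
    also have "\<dots> = (\<Sum>i\<in>UNIV.
        (if index_of i < ?k then cip (?q (index_of i)) (column j X) *s ?q (index_of i) else 0) +
        (if i = j then of_real (norm (gs_res enum X ?k)) *s ?q ?k else 0))"
      by (intro sum.cong refl) (auto simp: Y_def)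
    also have "\<dots> = (\<Sum>i | index_of (i :: 'a) < ?k. cip (?q (index_of i)) (column j X) *s ?q (index_of i)) +
        of_real (norm (gs_res enum X ?k)) *s ?q ?k"
      by (simp add: sum.distrib sum.inter_filter[of "UNIV :: 'a set", symmetric])
    also have "(\<Sum>i | index_of (i :: 'a) < ?k. cip (?q (index_of i)) (column j X) *s ?q (index_of i)) =
        (\<Sum>l<?k. cip (?q l) (column j X) *s ?q l)"
      using index_of_less[of j]
      by (intro sum.reindex_bij_witness[of _ enum index_of]) auto
    also have "of_real (norm (gs_res enum X ?k)) *s ?q ?k = gs_res enum X ?k"
      by (simp add: gs_col_eq[of _ _ ?k] scaleR_eq_smult[symmetric])
    finally show ?thesis by (simp add: gs_res_def)
  qed
  then show ?thesis by (blast intro: matrix_eq_columns)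
qed

lemma gs_mat_unitary:
  assumes "det X \<noteq> 0"
  shows "gs_mat X \<in> unitaries"
proof (rule unitariesI)
  obtain Y where "X = gs_mat X ** Y" using gs_mat_factor by blast
  then have "det (gs_mat X) \<noteq> 0" using assms det_mul[of "gs_mat X" Y] by auto
  then have inv: "inj ((*v) (gs_mat X))"
    by (simp add: inj_matrix_vector_mult invertible_det_nz)
  have nz: "gs_col enum X (index_of j) \<noteq> 0" for j :: 'a
  proof
    assume "gs_col enum X (index_of j) = 0"
    then have "gs_mat X *v axis j 1 = gs_mat X *v 0"
      by (simp add: mult_axis_eq_column column_gs_mat)
    then have "axis j (1::complex) = 0" using inv by (simp only: inj_eq)
    then show False by (simp add: axis_eq_0_iff)
  qed
  have "cip (gs_col enum X (index_of i)) (gs_col enum X (index_of j)) = (if i = j then 1 else 0)" for i j :: 'a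
  proof (cases "index_of i" "index_of j" rule: linorder_cases)
    case less
    then show ?thesis using gs_col_orthogonal by auto
  next
    case equal
    then show ?thesis using nz[of j] gs_col_norm[of enum X "index_of j"] by (simp add: cip_self)
  next
    case greater
    then show ?thesis
      using gs_col_orthogonal[OF greater, of enum X] cip_cnj[of "gs_col enum X (index_of i)"] by auto
  qed
  then show "adjoint_mat (gs_mat X) ** gs_mat X = mat 1"
    by (simp add: vec_eq_iff matrix_matrix_mult_def adjoint_mat_def gs_mat_def mat_def cip_def)
qed

lemma borel_measurable_vec_lambda:
  fixes f :: "'a \<Rightarrow> 'n::finite \<Rightarrow> 'b::euclidean_space"
  assumes "\<And>i. (\<lambda>x. f x i) \<in> borel_measurable M"
  shows "(\<lambda>x. \<chi> i. f x i) \<in> borel_measurable M"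
proof (rule borel_measurable_euclidean_space[THEN iffD2], rule ballI)
  fix b :: "'b^'n" assume "b \<in> Basis"
  have "(\<lambda>x. (\<chi> i. f x i) \<bullet> b) = (\<lambda>x. \<Sum>i\<in>UNIV. f x i \<bullet> b $ i)"
    by (simp add: inner_vec_def)
  also have "\<dots> \<in> borel_measurable M"
    using assms by measurable
  finally show "(\<lambda>x. (\<chi> i. f x i) \<bullet> b) \<in> borel_measurable M" .
qed

lemma measurable_gs_col: "(\<lambda>X. gs_col e X k) \<in> borel_measurable borel"
proof (induction k rule: less_induct)
  case (less k)
  have x [measurable]: "(\<lambda>X. column (e k) X) \<in> borel_measurable borel"
    unfolding column_def by (intro borel_measurable_continuous_onI continuous_intros)
  have "continuous_on UNIV (\<lambda>p :: (complex^'a) \<times> (complex^'a). cip (fst p) (snd p) *s fst p)"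
    unfolding cip_def vector_scalar_mult_def by (intro continuous_intros)
  then have c: "(\<lambda>p :: (complex^'a) \<times> (complex^'a). cip (fst p) (snd p) *s fst p) \<in> borel \<Otimes>\<^sub>M borel \<rightarrow>\<^sub>M borel"
    by (simp add: borel_prod borel_measurable_continuous_onI)
  have "(\<lambda>X. cip (gs_col e X j) (column (e k) X) *s gs_col e X j) \<in> borel_measurable borel"
    if "j < k" for j
    using measurable_compose[OF measurable_Pair[OF less[OF that] x] c] by simp
  then have [measurable]: "(\<lambda>X. gs_res e X k) \<in> borel_measurable borel"
    unfolding gs_res_def by (intro borel_measurable_diff borel_measurable_sum x) auto
  show ?case unfolding gs_col_eq by measurable
qed

lemma measurable_gs_mat: "gs_mat \<in> borel_measurable borel"
proof -
  have "(\<lambda>X. gs_col enum X (index_of j) $ i) \<in> borel_measurable borel" for i j :: 'a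
    by (rule measurable_compose[OF measurable_gs_col])
       (intro borel_measurable_continuous_onI continuous_intros)
  then show ?thesis
    unfolding gs_mat_def[abs_def] by (intro borel_measurable_vec_lambda)
qed

lemma is_haar_unitary_exists: "\<exists>\<mu> :: (complex^'n^'n) measure. is_haar_unitary \<mu>"
proof -
  define A :: "(complex^'n^'n) set" where "A = {X. det X \<noteq> 0} \<inter> ball 0 (norm (mat 1 :: complex^'n^'n) + 1)"
  define P where "P = uniform_measure lborel A"
  define Q :: "complex^'n^'n \<Rightarrow> complex^'n^'n" where "Q X = (if det X \<noteq> 0 then gs_mat X else mat 1)" for X
  define \<mu> where "\<mu> = distr P unitary_borel Q"
  have cdet: "continuous_on UNIV (det :: complex^'n^'n \<Rightarrow> complex)"
    unfolding det_def by (intro continuous_intros)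
  have "open A"
    unfolding A_def by (intro open_Int open_ball open_Collect_neq cdet continuous_on_const)
  then have [measurable]: "A \<in> sets borel" by simp
  have "mat 1 \<in> A" by (simp add: A_def)
  then have A0: "emeasure lborel A \<noteq> 0"
    using open_not_negligible[OF \<open>open A\<close>] null_setsI[of lborel A]
    by (auto simp: negligible_iff_null_sets null_sets_completion_iff)
  have "emeasure lborel A \<le> emeasure lborel (ball (0 :: complex^'n^'n) (norm (mat 1 :: complex^'n^'n) + 1))"
    by (intro emeasure_mono) (auto simp: A_def)
  also have "\<dots> < \<infinity>" by (rule emeasure_lborel_ball_finite)
  finally have Afin: "emeasure lborel A \<noteq> \<infinity>" by simp
  have P: "prob_space P"
    unfolding P_def by (rule prob_space_uniform_measure[OF A0 Afin])
  have sP [measurable_cong]: "sets P = sets borel" by (simp add: P_def)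
  have [measurable]: "Measurable.pred borel (\<lambda>X :: complex^'n^'n. det X = 0)"
    using borel_measurable_continuous_onI[OF cdet] by measurable
  note measurable_gs_mat [measurable]
  have "Q \<in> borel \<rightarrow>\<^sub>M unitary_borel"
    by (rule measurable_restrict_space2)
       (auto simp: Q_def[abs_def] gs_mat_unitary unitaries_one)
  then have Q: "Q \<in> P \<rightarrow>\<^sub>M unitary_borel" by (simp cong: measurable_cong_sets add: sP)
  have aeP: "AE X in P. det X \<noteq> 0"
    unfolding P_def by (rule AE_uniform_measureI) (auto simp: A_def)
  have "distr \<mu> \<mu> (\<lambda>U. V ** U) = \<mu>" if V: "V \<in> unitaries" for V
  proof -
    let ?L = "\<lambda>X :: complex^'n^'n. V ** X"
    have Lm: "?L \<in> unitary_borel \<rightarrow>\<^sub>M unitary_borel"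
      using V by (intro measurable_unitary_mult) (auto simp: space_unitary_borel)
    have [measurable]: "?L \<in> borel_measurable borel"
      by (intro borel_measurable_continuous_onI continuous_intros)
    have LP: "?L \<in> P \<rightarrow>\<^sub>M P" by measurable
    have lin: "linear ?L"
      by (rule linearI) (simp_all add: matrix_matrix_mult_def vec_eq_iff sum.distrib algebra_simps scaleR_sum_right)
    have detV: "det V \<noteq> 0"
      using V invertible_det_nz[of V] by (auto simp: unitaries_def invertible_def)
    then have LA: "?L -` A = A"
      by (auto simp: A_def det_mul norm_unitary_mult[OF V])
    have lb: "distr lborel borel ?L = lborel"
      by (rule lborel_distr_linear_isometry[OF lin norm_unitary_mult[OF V]])
    have PL: "distr P P ?L = P"
    proof (rule measure_eqI)
      fix B assume "B \<in> sets (distr P P ?L)"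
      then have [measurable]: "B \<in> sets borel" by (simp add: sP)
      have "emeasure (distr P P ?L) B = emeasure P (?L -` B)"
        using sets_eq_imp_space_eq[OF sP] by (subst emeasure_distr[OF LP]) (auto simp: sP)
      also have "\<dots> = emeasure lborel (?L -` (A \<inter> B)) / emeasure lborel A"
        using measurable_sets[of ?L borel borel B] by (simp add: P_def vimage_Int LA)
      also have "emeasure lborel (?L -` (A \<inter> B)) = emeasure (distr lborel borel ?L) (A \<inter> B)"
        by (subst emeasure_distr) auto
      also have "\<dots> / emeasure lborel A = emeasure P B"
        unfolding lb by (simp add: P_def)
      finally show "emeasure (distr P P ?L) B = emeasure P B" .
    qed simp
    have "distr \<mu> \<mu> ?L = distr \<mu> unitary_borel ?L"
      by (rule distr_cong) (auto simp: \<mu>_def)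
    also have "\<dots> = distr P unitary_borel (\<lambda>X. V ** Q X)"
      unfolding \<mu>_def by (subst distr_distr[OF Lm Q]) (simp add: o_def)
    also have "\<dots> = distr P unitary_borel (Q \<circ> ?L)"
    proof (rule distr_cong_AE)
      show "AE X in P. V ** Q X = (Q \<circ> ?L) X"
        using aeP by eventually_elim (simp add: Q_def gs_mat_mult[OF V] det_mul detV)
    qed (use measurable_compose[OF Q Lm] measurable_comp[OF LP Q] in \<open>auto simp: o_def\<close>)
    also have "\<dots> = distr (distr P P ?L) unitary_borel Q"
      by (subst distr_distr[OF Q LP]) simp
    finally show ?thesis by (simp add: PL \<mu>_def)
  qed
  moreover have "prob_space \<mu>"
    unfolding \<mu>_def by (rule prob_space.prob_space_distr[OF P Q])
  ultimately have "is_haar_unitary \<mu>"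
    by (simp add: is_haar_unitary_def \<mu>_def)
  then show ?thesis ..
qed

lemma is_haar_unitary_haar_unitary: "is_haar_unitary haar_unitary"
  unfolding haar_unitary_def
  using is_haar_unitary_exists is_haar_unitary_unique by (metis theI')

lemma haar_unitary_right_invariant:
  fixes V :: "complex^'n^'n"
  assumes V: "V \<in> unitaries"
  shows "distr haar_unitary haar_unitary (\<lambda>U. U ** V) = haar_unitary"
proof (rule is_haar_unitary_eqI)
  note h = is_haar_unitary_haar_unitary[where 'a = 'n]
  show s: "sets (haar_unitary :: (complex^'n^'n) measure) = sets unitary_borel"
    using h by (simp add: is_haar_unitary_def)
  then show "sets (distr haar_unitary haar_unitary (\<lambda>U. U ** V)) = sets unitary_borel" by simp
  fix f :: "complex^'n^'n \<Rightarrow> ennreal" assume f: "f \<in> borel_measurable unitary_borel"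
  have m: "(\<lambda>U. U ** V) \<in> unitary_borel \<rightarrow>\<^sub>M unitary_borel"
    using V by (intro measurable_unitary_mult) (auto simp: space_unitary_borel)
  then have m': "(\<lambda>U. U ** V) \<in> haar_unitary \<rightarrow>\<^sub>M haar_unitary"
    by (simp add: measurable_cong_sets[OF s s])
  note fV = measurable_compose[OF m f]
  have "(\<integral>\<^sup>+U. f U \<partial>distr haar_unitary haar_unitary (\<lambda>U. U ** V)) = (\<integral>\<^sup>+U. f (U ** V) \<partial>haar_unitary)"
    using m' f by (intro nn_integral_distr) (simp_all add: measurable_cong_sets[OF s refl])
  also have "\<dots> = (\<integral>\<^sup>+U. f (adjoint_mat (adjoint_mat V ** U)) \<partial>haar_unitary)"
    using haar_nn_integral_adjoint[OF h h fV] by (simp add: adjoint_mat_mult)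
  also have "\<dots> = (\<integral>\<^sup>+U. f (adjoint_mat U) \<partial>haar_unitary)"
    by (rule haar_nn_integral_left[OF h unitaries_adjoint[OF V]
          measurable_compose[OF measurable_unitary_adjoint f]])
  also have "\<dots> = (\<integral>\<^sup>+U. f U \<partial>haar_unitary)"
    by (rule haar_nn_integral_adjoint[OF h h f])
  finally show "(\<integral>\<^sup>+U. f U \<partial>distr haar_unitary haar_unitary (\<lambda>U. U ** V)) = (\<integral>\<^sup>+U. f U \<partial>haar_unitary)" .
qed

end

theory Submission
  imports Defs
begin

text \<open>
  Reshuffling the indices turns an operator \<open>M\<close> on \<open>H \<otimes> H\<close> into a linear map on operators, and
  conjugation of \<open>M\<close> by \<open>U \<otimes> U\<close> into conjugation of that map by \<open>X \<mapsto> U X U\<^sup>\<dagger>\<close>. The Haar average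
  projects onto the maps that commute with all unitary conjugations, which are exactly
  \<open>X \<mapsto> a X + b tr(X) 1\<close>; the average over the symmetry group projects onto the maps commuting with the
  group. Being a 2-design means that the two projections agree.

  If they agree, averaging the matrix unit \<open>E \<leftarrow> F\<close> of the basis gives a map whose \<open>(E', F')\<close> entry
  is the proportion of group elements taking \<open>(E, F)\<close> to \<open>(E', F')\<close>, while off the diagonal it is a
  multiple of one fixed matrix, \<open>tr(F')\<close> times the \<open>E'\<close> coordinate of \<open>1\<close>. Hence any two off-diagonal
  orbits have the same support and there is only one of them. Conversely, under a doubly transitive
  action the maps commuting with the group form a space of dimension at most two, already spanned by
  the identity and \<open>X \<mapsto> tr(X) 1\<close>, so every group average is fixed by the Haar average.
\<close>

section \<open>Operators on the tensor square as maps on operators\<close>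

lemma cscale_nth [simp]: "cscale c A $ i $ j = c * A $ i $ j"
  by (simp add: cscale_def)

lemma cscale_mult_left: "cscale c A ** B = cscale c (A ** B)"
  by (simp add: vec_eq_iff matrix_matrix_mult_def sum_distrib_left mult.assoc)

lemma cscale_mult_right: "A ** cscale c B = cscale c (A ** B)"
  by (simp add: vec_eq_iff matrix_matrix_mult_def sum_distrib_left mult.left_commute)

lemma matrix_add_rdistrib: "(A + B) ** C = A ** C + B ** C" for A B :: "complex^'n^'m"
  by (simp add: vec_eq_iff matrix_matrix_mult_def sum.distrib algebra_simps)

lemma sum_delta_pair:
  fixes f :: "'a::finite \<Rightarrow> 'b::finite \<Rightarrow> 'c::comm_monoid_add"
  shows "(\<Sum>x\<in>UNIV. \<Sum>y\<in>UNIV. if x = a \<and> y = b then f x y else 0) = f a b"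
proof -
  have "(\<Sum>x\<in>UNIV. \<Sum>y\<in>UNIV. if x = a \<and> y = b then f x y else 0) =
      (\<Sum>x\<in>UNIV. if x = a then \<Sum>y\<in>UNIV. if y = b then f x y else 0 else 0)"
    by (intro sum.cong) auto
  then show ?thesis by simp
qed

lemma adjoint_mat_cscale: "adjoint_mat (cscale c A) = cscale (cnj c) (adjoint_mat A)"
  by (simp add: vec_eq_iff adjoint_mat_def)

lemma adjoint_mat_add: "adjoint_mat (A + B) = adjoint_mat A + adjoint_mat B"
  by (simp add: vec_eq_iff adjoint_mat_def)

lemma conjugate_by_mult: "conjugate_by (A ** B) X = conjugate_by A (conjugate_by B X)"
  by (simp add: conjugate_by_def adjoint_mat_mult matrix_mul_assoc)

lemma conjugate_by_one [simp]: "conjugate_by (mat 1) X = X"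
  by (simp add: conjugate_by_def)

lemma conjugate_by_add: "conjugate_by A (X + Y) = conjugate_by A X + conjugate_by A Y"
  by (simp add: conjugate_by_def matrix_add_ldistrib matrix_add_rdistrib)

lemma conjugate_by_cscale: "conjugate_by A (cscale c X) = cscale c (conjugate_by A X)"
  by (simp add: conjugate_by_def cscale_mult_left cscale_mult_right)

lemma conjugate_by_zero [simp]: "conjugate_by A 0 = 0"
  using conjugate_by_cscale[of A 0 0] by simp

lemma conjugate_by_sum: "conjugate_by A (\<Sum>i\<in>I. f i) = (\<Sum>i\<in>I. conjugate_by A (f i))"
  by (induction I rule: infinite_finite_induct) (simp_all add: conjugate_by_add)

lemma conjugate_by_adjoint_cancel:
  assumes "U \<in> unitaries"
  shows "conjugate_by (adjoint_mat U) (conjugate_by U X) = X"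
    and "conjugate_by U (conjugate_by (adjoint_mat U) X) = X"
  using assms by (simp_all add: unitaries_def flip: conjugate_by_mult)

lemma conjugate_by_inj: "U \<in> unitaries \<Longrightarrow> conjugate_by U X = conjugate_by U Y \<Longrightarrow> X = Y"
  by (metis conjugate_by_adjoint_cancel(1))

lemma kron_mult: "kron A B ** kron C D = kron (A ** C) (B ** D)"
  by (simp add: vec_eq_iff matrix_matrix_mult_def kron_def sum_product sum.cartesian_product
      case_prod_beta mult.assoc mult.left_commute)

lemma kron_cscale: "kron (cscale c A) (cscale c' B) = cscale (c * c') (kron A B)"
  by (simp add: vec_eq_iff kron_def)

lemma conjugate_by_phase:
  assumes "cmod c = 1"
  shows "conjugate_by (cscale c A) X = conjugate_by A X"
proof -
  have "c * cnj c = 1" using assms by (simp add: complex_norm_square[symmetric])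
  then show ?thesis
    by (simp add: conjugate_by_def adjoint_mat_cscale cscale_mult_left cscale_mult_right mult.commute)
qed

definition munit :: "'m \<Rightarrow> 'n \<Rightarrow> complex^'n^'m" where
  "munit i j = (\<chi> k l. if k = i \<and> l = j then 1 else 0)"

lemma munit_nth: "munit i j $ k $ l = (if k = i \<and> l = j then 1 else 0)"
  by (simp add: munit_def)

lemma munit_mult_nth: "(munit i j ** Z) $ k $ l = (if k = i then Z $ j $ l else 0)"
  by (simp add: munit_nth matrix_matrix_mult_def if_distrib if_distribR cong: if_cong)

lemma mult_munit_nth: "(Z ** munit i j) $ k $ l = (if l = j then Z $ k $ i else 0)"
  by (simp add: munit_nth matrix_matrix_mult_def if_distrib if_distribR cong: if_cong)

lemma munit_expansion: "X = (\<Sum>i\<in>UNIV. \<Sum>j\<in>UNIV. cscale (X $ i $ j) (munit i j))"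
proof -
  have "(\<Sum>i\<in>UNIV. \<Sum>j\<in>UNIV. cscale (X $ i $ j) (munit i j)) $ k $ l = 
    (\<Sum>i\<in>UNIV. \<Sum>j\<in>UNIV. if i = k \<and> j = l then X $ i $ j else 0)" for k l
    unfolding sum_component by (intro sum.cong refl) (simp add: munit_nth)
  then show ?thesis by (simp add: vec_eq_iff sum_delta_pair)
qed

text \<open>Commuting with the matrix units is enough: comparing entries of
  \<open>munit i j ** N\<close> and \<open>N ** munit i j\<close> kills the off-diagonal entries and
  makes the diagonal constant.\<close>

lemma commutes_imp_scalar:
  fixes N :: "complex^'n^'n"
  assumes "\<And>A. A ** N = N ** A"
  shows "\<exists>c. N = cscale c (mat 1)"
proof -
  have *: "(if k = i then N $ j $ l else 0) = (if l = j then N $ k $ i else 0)" for i j k l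
    using assms[of "munit i j"] by (metis munit_mult_nth mult_munit_nth)
  have diag: "N $ k $ k = N $ undefined $ undefined" for k
    using *[where i=k and k=k and j="undefined" and l="undefined"] by simp
  have off: "N $ k $ l = 0" if "k \<noteq> l" for k l
    using *[where k=k and i=l and j=l and l=l] that by simp
  have "N = cscale (N $ undefined $ undefined) (mat 1)"
    using diag off by (simp add: vec_eq_iff mat_def)
  then show ?thesis by blast
qed

text \<open>The partial trace \<open>X \<mapsto> tr\<^sub>2 (M (1 \<otimes> X))\<close> over the second factor.\<close>

definition superop :: "complex^('n::finite \<times> 'n)^('n \<times> 'n) \<Rightarrow> complex^'n^'n \<Rightarrow> complex^'n^'n" where
  "superop M X = (\<chi> i k. \<Sum>b\<in>UNIV. \<Sum>d\<in>UNIV. M $ (i, b) $ (k, d) * X $ d $ b)"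

lemma superop_nth: "superop M X $ i $ k = (\<Sum>b\<in>UNIV. \<Sum>d\<in>UNIV. M $ (i, b) $ (k, d) * X $ d $ b)"
  by (simp add: superop_def)

lemma superop_add: "superop M (X + Y) = superop M X + superop M Y"
  by (simp add: vec_eq_iff superop_nth sum.distrib algebra_simps)

lemma superop_cscale: "superop M (cscale c X) = cscale c (superop M X)"
  by (simp add: vec_eq_iff superop_nth sum_distrib_left mult.left_commute)

lemma superop_zero [simp]: "superop M 0 = 0"
  by (simp add: vec_eq_iff superop_nth)

lemma superop_sum: "superop M (\<Sum>i\<in>I. f i) = (\<Sum>i\<in>I. superop M (f i))"
  by (induction I rule: infinite_finite_induct) (simp_all add: superop_add)

lemma superop_diff: "superop M (X - Y) = superop M X - superop M Y"
  by (metis add_diff_cancel diff_add_cancel superop_add)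

lemma superop_sum_left: "superop (\<Sum>i\<in>I. f i) X = (\<Sum>i\<in>I. superop (f i) X)"
proof (induction I rule: infinite_finite_induct)
  case (insert a I)
  then show ?case by (simp add: vec_eq_iff superop_nth sum.distrib algebra_simps)
qed (simp_all add: vec_eq_iff superop_nth)

lemma superop_cscale_left: "superop (cscale c M) X = cscale c (superop M X)"
  by (simp add: vec_eq_iff superop_nth sum_distrib_left mult.assoc)

lemma superop_munit: "superop M (munit d b) $ i $ k = M $ (i, b) $ (k, d)"
proof -
  have "superop M (munit d b) $ i $ k = 
     (\<Sum>b'\<in>UNIV. \<Sum>d'\<in>UNIV. if b' = b \<and> d' = d then M $ (i, b') $ (k, d') else 0)"
    unfolding superop_nth by (intro sum.cong refl) (simp add: munit_nth)
  then show ?thesis by (simp add: sum_delta_pair)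
qed

text \<open>By \<open>superop_munit\<close> the values on matrix units are the entries of
  \<open>M\<close> in another order. Equalities of operators on the tensor square can therefore be
  tested on the associated maps.\<close>

lemma superop_eqI:
  assumes "\<And>d b. superop M (munit d b) = superop N (munit d b)"
  shows "M = N"
proof -
  have "M $ (i, b) $ (k, d) = N $ (i, b) $ (k, d)" for i b k d
    using assms by (metis superop_munit)
  then show ?thesis by (simp add: vec_eq_iff)
qed

lemma superop_one: "superop (mat 1) X = cscale (trace X) (mat 1)"
proof -
  have "superop (mat 1) X $ i $ k = (\<Sum>b\<in>UNIV. \<Sum>d\<in>UNIV. if b = d then (if i = k then X $ d $ b else 0) else 0)" for i k
    unfolding superop_nth by (intro sum.cong refl) (simp add: mat_def)
  then show ?thesis by (auto simp: vec_eq_iff trace_def mat_def)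
qed

text \<open>The witness inverts the reshuffling of \<open>superop_munit\<close>, so an operator on
  the tensor square can be introduced by prescribing its linear map.\<close>

lemma superop_surj:
  assumes add: "\<And>X Y. \<Phi> (X + Y) = \<Phi> X + \<Phi> Y"
    and scale: "\<And>c X. \<Phi> (cscale c X) = cscale c (\<Phi> X)"
  shows "\<exists>M. \<forall>X. superop M X = \<Phi> X"
proof -
  define M where "M = (\<chi> p q. \<Phi> (munit (snd q) (snd p)) $ fst p $ fst q)"
  have z: "\<Phi> 0 = 0" using scale[of 0 0] by simp
  have sum: "\<Phi> (\<Sum>i\<in>I. f i) = (\<Sum>i\<in>I. \<Phi> (f i))" for f and I :: "'a set"
    by (induction I rule: infinite_finite_induct) (simp_all add: add z)
  have u: "superop M (munit d b) = \<Phi> (munit d b)" for d b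
    by (simp add: vec_eq_iff superop_munit M_def)
  have "superop M X = \<Phi> X" for X
    by (subst (1 2) munit_expansion[of X]) (simp add: superop_sum superop_cscale sum scale u)
  then show ?thesis by blast
qed

text \<open>The first copy of \<open>U\<close> acts on the output. The second copy sits inside the
  partial trace and moves by cyclicity onto the argument, where it appears as the adjoint.\<close>

lemma superop_conjugate:
  "superop (conjugate_by (kron U U) M) X = conjugate_by U (superop M (conjugate_by (adjoint_mat U) X))"
proof -
  let ?T = "UNIV :: ('a \<times> 'a \<times> 'a \<times> 'a \<times> 'a \<times> 'a) set"
  let ?T' = "UNIV :: ('a \<times> 'a \<times> ('a \<times> 'a) \<times> 'a \<times> 'a) set"
  have L: "superop (conjugate_by (kron U U) M) X $ i $ k =
     (\<Sum>(b, d, (c', d'), a', b')\<in>?T'. U $ i $ a' * U $ b $ b' * M $ (a', b') $ (c', d') *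
        cnj (U $ k $ c') * cnj (U $ d $ d') * X $ d $ b)" for i k
    by (simp add: superop_nth conjugate_by_def matrix_matrix_mult_def kron_def adjoint_mat_def
        sum_distrib_left sum_distrib_right mult.assoc sum.cartesian_product case_prod_beta flip: UNIV_Times_UNIV)
  have R: "conjugate_by U (superop M (conjugate_by (adjoint_mat U) X)) $ i $ k =
     (\<Sum>(c', a', b', d', b, d)\<in>?T. U $ i $ a' * U $ b $ b' * M $ (a', b') $ (c', d') *
        cnj (U $ k $ c') * cnj (U $ d $ d') * X $ d $ b)" for i k
    by (simp add: superop_nth conjugate_by_def matrix_matrix_mult_def kron_def adjoint_mat_def
        sum_distrib_left sum_distrib_right sum.cartesian_product case_prod_beta mult_ac)
  have "(\<Sum>(b, d, (c', d'), a', b')\<in>?T'. U $ i $ a' * U $ b $ b' * M $ (a', b') $ (c', d') *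
        cnj (U $ k $ c') * cnj (U $ d $ d') * X $ d $ b) =
      (\<Sum>(c', a', b', d', b, d)\<in>?T. U $ i $ a' * U $ b $ b' * M $ (a', b') $ (c', d') *
        cnj (U $ k $ c') * cnj (U $ d $ d') * X $ d $ b)" for i k
    \<comment> \<open>Both sides are the same sixfold sum; the witnesses only rearrange the tuple of
      summation indices.\<close>
    by (rule sum.reindex_bij_witness[of _ "\<lambda>(c', a', b', d', b, d). (b, d, (c', d'), a', b')"
          "\<lambda>(b, d, (c', d'), a', b'). (c', a', b', d', b, d)"]) auto
  with L R show ?thesis by (simp add: vec_eq_iff)
qed

section \<open>Maps commuting with all unitary conjugations\<close>

definition commutator :: "complex^'n^'n \<Rightarrow> complex^'n^'n \<Rightarrow> complex^'n^'n" where
  "commutator A X = A ** X - X ** A"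

lemma commutator_add_left: "commutator (A + B) X = commutator A X + commutator B X"
  by (simp add: commutator_def matrix_add_ldistrib matrix_add_rdistrib)

lemma commutator_cscale_left: "commutator (cscale c A) X = cscale c (commutator A X)"
  by (simp add: commutator_def cscale_mult_left cscale_mult_right cmat.scale_right_diff_distrib)

lemma commutator_cscale_right: "commutator A (cscale c X) = cscale c (commutator A X)"
  by (simp add: commutator_def cscale_mult_left cscale_mult_right cmat.scale_right_diff_distrib)

lemma commutator_zero_left [simp]: "commutator 0 X = 0"
  using commutator_cscale_left[of 0 0 X] by simp

lemma commutator_sum_left: "commutator (\<Sum>i\<in>I. f i) X = (\<Sum>i\<in>I. commutator (f i) X)"
  by (induction I rule: infinite_finite_induct) (simp_all add: commutator_add_left)

lemma commutator_diff_right: "commutator A (X - Y) = commutator A X - commutator A Y"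
proof -
  have "commutator A (X - Y) + commutator A Y = commutator A X"
    by (simp add: commutator_def algebra_simps flip: matrix_add_ldistrib matrix_add_rdistrib)
  then show ?thesis by (simp add: eq_diff_eq)
qed

lemma commutator_munit_left:
  "commutator (munit i j) X $ k $ l = (if k = i then X $ j $ l else 0) - (if l = j then X $ k $ i else 0)"
  by (simp add: commutator_def munit_mult_nth mult_munit_nth)

definition projector :: "complex^'n^'n \<Rightarrow> bool" where
  "projector P \<longleftrightarrow> adjoint_mat P = P \<and> P ** P = P"

text \<open>The unitary \<open>1 + (\<i> - 1) P\<close> is \<open>exp (\<i> \<pi> P / 2)\<close>; comparing conjugation by it and by its
  inverse isolates the commutator with \<open>P\<close>.\<close>

lemma projector_rotation:
  fixes P :: "complex^'n^'n"
  assumes "projector P"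
  defines "U \<equiv> mat 1 + cscale (\<i> - 1) P"
  shows "U \<in> unitaries"
    and "conjugate_by U X - conjugate_by (adjoint_mat U) X = cscale (2 * \<i>) (commutator P X)"
proof -
  have P: "adjoint_mat P = P" "P ** P = P" using assms by (auto simp: projector_def)
  have a: "adjoint_mat U = mat 1 + cscale (- \<i> - 1) P"
    by (simp add: U_def adjoint_mat_add adjoint_mat_cscale P)
  have "adjoint_mat U ** U = mat 1"
    unfolding a by (simp add: U_def P matrix_add_ldistrib matrix_add_rdistrib cscale_mult_left cscale_mult_right)
       (simp add: vec_eq_iff algebra_simps)
  then show "U \<in> unitaries" by (rule unitariesI)
  have "conjugate_by U X = X + cscale (\<i> - 1) (P ** X) + cscale (- \<i> - 1) (X ** P) + cscale 2 (P ** X ** P)"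
    unfolding conjugate_by_def a
    by (simp add: U_def matrix_add_ldistrib matrix_add_rdistrib cscale_mult_left cscale_mult_right
          algebra_simps del: cmat.scale_left_diff_distrib)
  moreover have "conjugate_by (adjoint_mat U) X =
      X + cscale (- \<i> - 1) (P ** X) + cscale (\<i> - 1) (X ** P) + cscale 2 (P ** X ** P)"
    unfolding conjugate_by_def adjoint_mat_adjoint unfolding a
    by (simp add: U_def matrix_add_ldistrib matrix_add_rdistrib cscale_mult_left cscale_mult_right
          algebra_simps del: cmat.scale_left_diff_distrib)
  ultimately show "conjugate_by U X - conjugate_by (adjoint_mat U) X = cscale (2 * \<i>) (commutator P X)"
    by (simp only:) (simp add: commutator_def vec_eq_iff algebra_simps)
qed

definition unitarily_invariant :: "complex^('n::finite \<times> 'n)^('n \<times> 'n) \<Rightarrow> bool" where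
  "unitarily_invariant M \<longleftrightarrow> (\<forall>U\<in>unitaries. conjugate_by (kron U U) M = M)"

lemma superop_conjugate_invariant:
  assumes "conjugate_by (kron U U) M = M" "U \<in> unitaries"
  shows "superop M (conjugate_by U X) = conjugate_by U (superop M X)"
  using superop_conjugate[of U M "conjugate_by U X"] assms
  by (simp add: conjugate_by_adjoint_cancel)

text \<open>A derivative-free passage from the group to its Lie algebra: the map commutes with
  conjugation by the rotation and by its inverse, hence with the difference, a nonzero multiple of
  the commutator.\<close>

lemma superop_commutator_projector:
  assumes M: "unitarily_invariant M" and P: "projector P"
  shows "superop M (commutator P X) = commutator P (superop M X)"
proof -
  let ?U = "mat 1 + cscale (\<i> - 1) P"
  note U = projector_rotation[OF P]
  have "cscale (2 * \<i>) (superop M (commutator P X)) = superop M (conjugate_by ?U X - conjugate_by (adjoint_mat ?U) X)"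
    by (simp add: U(2) superop_cscale)
  also have "\<dots> = conjugate_by ?U (superop M X) - conjugate_by (adjoint_mat ?U) (superop M X)"
    using M U(1) unitaries_adjoint[OF U(1)]
    by (simp add: superop_diff superop_conjugate_invariant unitarily_invariant_def)
  also have "\<dots> = cscale (2 * \<i>) (commutator P (superop M X))"
    by (rule U(2))
  finally show ?thesis by simp
qed

lemma adjoint_mat_munit: "adjoint_mat (munit i j) = munit j i"
  by (auto simp: vec_eq_iff adjoint_mat_def munit_nth)

lemma munit_mult: "munit i j ** munit k l = (if j = k then munit i l else 0)"
  by (auto simp: vec_eq_iff munit_mult_nth munit_nth)

lemma projector_munit: "projector (munit i i)"
  by (simp add: projector_def adjoint_mat_munit munit_mult)

text \<open>This is the rank-one projector onto the line through
  \<open>axis i 1 + cnj c *s axis j 1\<close>. Varying the phase \<open>c\<close> supplies the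
  projectors needed for polarization.\<close>

lemma projector_superposition:
  assumes "i \<noteq> j" "c * cnj c = 1"
  shows "projector (cscale (1/2) (munit i i + munit j j + cscale c (munit i j) + cscale (cnj c) (munit j i)))"
    (is "projector ?P")
proof -
  have c: "c * (cnj c * z) = z" "cnj c * (c * z) = z" for z
    using assms(2) by (metis mult.assoc mult_1, metis mult.assoc mult.commute mult_1)
  have "adjoint_mat ?P = ?P"
    by (simp add: adjoint_mat_add adjoint_mat_cscale adjoint_mat_munit add_ac)
  moreover have "?P ** ?P = ?P"
    using assms(1)
    by (simp add: matrix_add_ldistrib matrix_add_rdistrib cscale_mult_left cscale_mult_right munit_mult)
       (simp add: vec_eq_iff algebra_simps c)
  ultimately show ?thesis by (simp add: projector_def)
qed

lemma superop_commutator: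
  assumes M: "unitarily_invariant M"
  shows "superop M (commutator A X) = commutator A (superop M X)"
proof -
  have unit: "superop M (commutator (munit i j) X) = commutator (munit i j) (superop M X)" for i j
  proof (cases "i = j")
    case True
    then show ?thesis using superop_commutator_projector[OF M projector_munit] by simp
  next
    case False
    define P :: "complex \<Rightarrow> complex^'a^'a" where
      "P c = cscale (1/2) (munit i i + munit j j + cscale c (munit i j) + cscale (cnj c) (munit j i))" for c
    have P: "superop M (commutator (P c) X) = commutator (P c) (superop M X)" if "c * cnj c = 1" for c
      unfolding P_def by (rule superop_commutator_projector[OF M projector_superposition[OF False that]])
    \<comment> \<open>Polarization: \<open>P 1 - P (-1)\<close> is
      \<open>munit i j + munit j i\<close>, and the two terms with \<i> add up to
      \<open>munit i j - munit j i\<close>.\<close>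
    have "munit i j = cscale (1/2) (P 1 + cscale (-1) (P (-1)) + cscale (-\<i>) (P \<i>) + cscale \<i> (P (-\<i>)))"
      by (simp add: P_def vec_eq_iff algebra_simps)
    then show ?thesis
      by (simp add: commutator_add_left commutator_cscale_left superop_add superop_cscale P del: cmat.scale_minus_left)
  qed
  show ?thesis
    by (subst (1 2) munit_expansion[of A])
       (simp add: commutator_sum_left commutator_cscale_left superop_sum superop_cscale unit)
qed

text \<open>Under the reshuffling, the identity map corresponds to the swap operator and the map
  with coefficient \<open>b\<close> to the identity of the tensor square, so this describes the span
  of these two operators.\<close>

definition isotropic :: "complex^('n::finite \<times> 'n)^('n \<times> 'n) \<Rightarrow> bool" where
  "isotropic M \<longleftrightarrow> (\<exists>a b. \<forall>X. superop M X = cscale a X + cscale (b * trace X) (mat 1))"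

lemma trace_commutator: "trace (commutator A X) = 0"
  by (simp add: commutator_def trace_sub trace_mul_sym[of A])

lemma commutator_munit_munit:
  "commutator (munit i j) (munit k l) =
     (if j = k then munit i l else 0) - (if l = i then munit k j else 0)"
  by (auto simp: vec_eq_iff commutator_munit_left munit_nth)

text \<open>Off-diagonal matrix units are weight vectors for commutators with diagonal units, hence
  eigenvectors of the map. Commutators between them equate all eigenvalues, and the remaining
  freedom on the diagonal is one matrix \<open>N\<close> that must be central.\<close>

lemma unitarily_invariant_imp_isotropic:
  fixes M :: "complex^('n::finite \<times> 'n)^('n \<times> 'n)"
  assumes M: "unitarily_invariant M"
  shows "isotropic M"
proof -
  note comm = superop_commutator[OF M]
  define l where "l i j = superop M (munit i j) $ i $ j" for i j
  \<comment> \<open>Commutation with \<open>munit i i\<close> fixes \<open>munit i j\<close> and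
    commutation with \<open>munit j j\<close> negates it; the image inherits both relations, which
    leave only its \<open>(i, j)\<close> entry.\<close>
  have off: "superop M (munit i j) = cscale (l i j) (munit i j)" if "i \<noteq> j" for i j
  proof -
    have 1: "superop M (munit i j) = commutator (munit i i) (superop M (munit i j))"
      using that comm[of "munit i i" "munit i j"] by (simp add: commutator_munit_munit)
    have "superop M (munit i j) + commutator (munit j j) (superop M (munit i j)) =
        superop M (munit i j + commutator (munit j j) (munit i j))"
      by (simp add: comm superop_add)
    also have "\<dots> = 0" using that by (simp add: commutator_munit_munit)
    finally have 2: "superop M (munit i j) + commutator (munit j j) (superop M (munit i j)) = 0" .
    let ?Z = "superop M (munit i j)"
    have e1: "?Z $ k $ m = (if k = i then ?Z $ i $ m else 0) - (if m = i then ?Z $ k $ i else 0)" for k m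
      using arg_cong[OF 1, of "\<lambda>Z. Z $ k $ m"] by (simp only: commutator_munit_left)
    have e2: "?Z $ k $ m + ((if k = j then ?Z $ j $ m else 0) - (if m = j then ?Z $ k $ j else 0)) = 0" for k m
      using arg_cong[OF 2, of "\<lambda>Z. Z $ k $ m"] by (simp only: commutator_munit_left vector_add_component zero_index)
    have "?Z $ k $ m = 0" if "\<not> (k = i \<and> m = j)" for k m
    proof (cases "k = i")
      case True
      then show ?thesis using e2[of k m] that \<open>i \<noteq> j\<close> by simp
    next
      case False
      then show ?thesis using e1[of k m] by (cases "m = i") auto
    qed
    then show ?thesis by (auto simp: vec_eq_iff munit_nth l_def)
  qed
  \<comment> \<open>The relation used is that the commutator of \<open>munit i j\<close> and
    \<open>munit j k\<close> is \<open>munit i k\<close>.\<close>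
  have l1: "l i k = l j k" if "i \<noteq> k" "j \<noteq> k" for i j k
  proof -
    have "cscale (l i k) (munit i k) = cscale (l j k) (munit i k)"
      using comm[of "munit i j" "munit j k"] that
      by (simp add: commutator_munit_munit off commutator_cscale_right)
    from arg_cong[OF this, of "\<lambda>Z. Z $ i $ k"] show ?thesis by (simp add: munit_nth)
  qed
  have swap: "superop M (munit i i - munit j j) = cscale (l j i) (munit i i - munit j j)" if "i \<noteq> j" for i j
    using comm[of "munit i j" "munit j i"] that
    by (simp add: commutator_munit_munit off commutator_cscale_right)
  \<comment> \<open>Exchanging \<open>i\<close> and \<open>j\<close> in \<open>swap\<close> negates
    the vector, so its two eigenvalues agree.\<close>
  have l2: "l i j = l j i" if "i \<noteq> j" for i j
  proof -
    have "cscale (l j i) (munit i i - munit j j) + cscale (l i j) (munit j j - munit i i) = superop M 0"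
      unfolding swap[OF that, symmetric] swap[OF that[symmetric], symmetric] superop_add[symmetric] by simp
    from arg_cong[OF this, of "\<lambda>Z. Z $ i $ i"] that show ?thesis by (simp add: munit_nth)
  qed
  have l3: "l i j = l k m" if "i \<noteq> j" "k \<noteq> m" for i j k m
  proof (cases "k = j")
    case True
    have "l i j = l m j" using l1[of i j m] \<open>i \<noteq> j\<close> \<open>k \<noteq> m\<close> True by simp
    also have "\<dots> = l k m" using l2[of k m] \<open>k \<noteq> m\<close> True by simp
    finally show ?thesis .
  next
    case False
    then have "l i j = l k j" using l1[of i j k] \<open>i \<noteq> j\<close> False by simp
    also have "\<dots> = l j k" using l2[of k j] False by simp
    also have "\<dots> = l m k" using l1[of j k m] False \<open>k \<noteq> m\<close> by simp
    also have "\<dots> = l k m" using l2[of k m] \<open>k \<noteq> m\<close> by simp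
    finally show ?thesis .
  qed
  have "\<exists>a. \<forall>i j. i \<noteq> j \<longrightarrow> l i j = a"
  proof (cases "\<exists>i j :: 'n. i \<noteq> j")
    case True
    then obtain i j :: 'n where "i \<noteq> j" by blast
    then have "\<forall>p q. p \<noteq> q \<longrightarrow> l p q = l i j" using l3 by blast
    then show ?thesis ..
  qed simp
  then obtain a where a: "\<And>i j. i \<noteq> j \<Longrightarrow> l i j = a"
    by blast
  \<comment> \<open>The index \<open>u\<close> is an arbitrary reference. Since
    \<open>munit i i - munit u u\<close> has eigenvalue \<open>a\<close>, the defect
    \<open>N\<close> of the diagonal units is the same for every index.\<close>
  define u :: 'n where "u = undefined"
  define N where "N = superop M (munit u u) - cscale a (munit u u)"
  have "superop M (munit i i) = cscale a (munit i i) + N" for i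
  proof (cases "i = u")
    case False
    then show ?thesis using swap[of i u] a[of u i]
      by (simp add: N_def superop_diff cmat.scale_right_diff_distrib algebra_simps)
  qed (simp add: N_def)
  then have unit: "superop M (munit i j) = cscale a (munit i j) + cscale (if i = j then 1 else 0) N" for i j
    using off[of i j] a[of i j] by auto
  have "\<exists>M'. \<forall>X. superop M' X = cscale a X + cscale (trace X) N"
    by (rule superop_surj)
       (simp_all add: vec_eq_iff trace_def sum.distrib algebra_simps sum_distrib_left)
  then obtain M' where M': "\<And>X. superop M' X = cscale a X + cscale (trace X) N"
    by blast
  have "superop M (munit d b) = superop M' (munit d b)" for b d
  proof -
    have "trace (munit d b :: complex^'n^'n) = (if d = b then 1 else 0)"
      by (cases "d = b") (auto simp: trace_def munit_nth intro!: sum.neutral)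
    then show ?thesis by (simp add: unit M')
  qed
  then have "M = M'" by (rule superop_eqI)
  then have full: "superop M X = cscale a X + cscale (trace X) N" for X
    by (simp add: M')
  \<comment> \<open>A commutator has trace zero, so the \<open>N\<close> term disappears from its
    image; comparison with the commutator of the image forces \<open>N\<close> to commute with
    \<open>A\<close>.\<close>
  have "A ** N = N ** A" for A
  proof -
    have "cscale a (commutator A (munit u u)) = commutator A (superop M (munit u u))"
      using comm[of A "munit u u"] by (simp add: full trace_commutator)
    then have "commutator A N = 0"
      unfolding N_def by (simp add: commutator_diff_right commutator_cscale_right)
    then show ?thesis by (simp add: commutator_def)
  qed
  then obtain b where "N = cscale b (mat 1)" using commutes_imp_scalar by blast
  then have "superop M X = cscale a X + cscale (b * trace X) (mat 1)" for X
    by (simp add: full mult.commute)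
  then show ?thesis unfolding isotropic_def by blast
qed

lemma trace_conjugate_by: "U \<in> unitaries \<Longrightarrow> trace (conjugate_by U X) = trace X"
  by (simp add: conjugate_by_def trace_mul_sym[of "U ** X"] matrix_mul_assoc unitaries_def)

lemma isotropic_imp_unitarily_invariant:
  assumes "isotropic M"
  shows "unitarily_invariant M"
  unfolding unitarily_invariant_def
proof
  fix U :: "complex^'a^'a" assume U: "U \<in> unitaries"
  obtain a b where M: "\<And>X. superop M X = cscale a X + cscale (b * trace X) (mat 1)"
    using assms by (auto simp: isotropic_def)
  have "conjugate_by U (mat 1) = mat 1"
    using U by (simp add: conjugate_by_def unitaries_def)
  then show "conjugate_by (kron U U) M = M"
    by (intro superop_eqI) (simp add: superop_conjugate M conjugate_by_add conjugate_by_cscale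
        conjugate_by_adjoint_cancel U trace_conjugate_by unitaries_adjoint)
qed

section \<open>Haar averages\<close>

definition haar_twirl :: "complex^('n::finite \<times> 'n)^('n \<times> 'n) \<Rightarrow> complex^('n \<times> 'n)^('n \<times> 'n)" where
  "haar_twirl M = (\<integral>U. conjugate_by (kron U U) M \<partial>haar_unitary)"

lemma compact_unitaries: "compact (unitaries :: (complex^'n^'n) set)"
proof -
  have "norm U \<le> norm (mat 1 :: complex^'n^'n)" if "U \<in> unitaries" for U :: "complex^'n^'n"
    using norm_unitary_mult[OF that, of "mat 1"] by simp
  then have "bounded (unitaries :: (complex^'n^'n) set)"
    by (rule boundedI)
  then show ?thesis by (simp add: closed_unitaries compact_eq_bounded_closed)
qed

lemma sets_haar_unitary: "sets haar_unitary = sets unitary_borel"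
  by (rule is_haar_unitary_haar_unitary[unfolded is_haar_unitary_def, THEN conjunct1])

lemma space_haar_unitary: "space haar_unitary = unitaries"
  using sets_eq_imp_space_eq[OF sets_haar_unitary] by (simp add: space_unitary_borel)

lemma prob_space_haar_unitary: "prob_space haar_unitary"
  by (rule is_haar_unitary_haar_unitary[unfolded is_haar_unitary_def, THEN conjunct2, THEN conjunct1])

lemma continuous_on_twirl_integrand: "continuous_on A (\<lambda>U. conjugate_by (kron U U) M)"
  unfolding conjugate_by_def kron_def by (intro continuous_intros)

lemma measurable_twirl_integrand: "(\<lambda>U. conjugate_by (kron U U) M) \<in> borel_measurable haar_unitary"
  unfolding measurable_cong_sets[OF sets_haar_unitary refl]
  by (intro measurable_restrict_space1 borel_measurable_continuous_onI continuous_on_twirl_integrand)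

text \<open>Compactness of the unitary group bounds the continuous integrand. Integrability is what
  lets sums and linear maps pass through the Bochner integral below.\<close>

lemma integrable_twirl_integrand: "integrable haar_unitary (\<lambda>U. conjugate_by (kron U U) M)"
proof -
  interpret prob_space "haar_unitary :: (complex^'a^'a) measure" by (rule prob_space_haar_unitary)
  have "bounded ((\<lambda>U. conjugate_by (kron U U) M) ` unitaries)"
    by (intro compact_imp_bounded compact_continuous_image continuous_on_twirl_integrand compact_unitaries)
  then obtain C where "\<And>U. U \<in> unitaries \<Longrightarrow> norm (conjugate_by (kron U U) M) \<le> C"
    by (auto simp: bounded_iff)
  then show ?thesis
    by (intro integrable_const_bound[of _ C] measurable_twirl_integrand AE_I2) (simp add: space_haar_unitary)
qed

lemma scaleR_eq_cscale: "r *\<^sub>R A = cscale (of_real r) A" for A :: "complex^'n^'m"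
  by (simp add: vec_eq_iff scaleR_conv_of_real[where 'a=complex])

lemma bounded_linear_conjugate_by: "bounded_linear (conjugate_by A)"
  by (intro linear_conv_bounded_linear[THEN iffD1] linearI)
     (simp_all add: conjugate_by_add conjugate_by_cscale scaleR_eq_cscale)

lemma bounded_linear_cscale: "bounded_linear (cscale c :: complex^'n^'m \<Rightarrow> _)"
  by (intro linear_conv_bounded_linear[THEN iffD1] linearI)
     (simp_all add: scaleR_eq_cscale cmat.scale_right_distrib mult.commute)

lemma haar_twirl_cscale: "haar_twirl (cscale c M) = cscale c (haar_twirl M)"
  unfolding haar_twirl_def conjugate_by_cscale
  by (rule integral_bounded_linear[OF bounded_linear_cscale integrable_twirl_integrand])

lemma haar_twirl_sum: "haar_twirl (\<Sum>i\<in>I. f i) = (\<Sum>i\<in>I. haar_twirl (f i))"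
  unfolding haar_twirl_def conjugate_by_sum
  by (rule Bochner_Integration.integral_sum) (rule integrable_twirl_integrand)

lemma measurable_haar_mult:
  assumes "V \<in> unitaries"
  shows "(\<lambda>U. V ** U) \<in> haar_unitary \<rightarrow>\<^sub>M haar_unitary" "(\<lambda>U. U ** V) \<in> haar_unitary \<rightarrow>\<^sub>M haar_unitary"
  using assms unfolding measurable_cong_sets[OF sets_haar_unitary sets_haar_unitary]
  by (auto intro!: measurable_unitary_mult simp: space_unitary_borel)

lemma haar_twirl_left:
  assumes "V \<in> unitaries"
  shows "conjugate_by (kron V V) (haar_twirl M) = haar_twirl M"
proof -
  have "conjugate_by (kron V V) (haar_twirl M) =
      (\<integral>U. conjugate_by (kron V V) (conjugate_by (kron U U) M) \<partial>haar_unitary)"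
    unfolding haar_twirl_def
    by (rule integral_bounded_linear[OF bounded_linear_conjugate_by integrable_twirl_integrand, symmetric])
  also have "\<dots> = (\<integral>U. conjugate_by (kron (V ** U) (V ** U)) M \<partial>haar_unitary)"
    by (simp flip: conjugate_by_mult kron_mult)
  also have "\<dots> = (\<integral>U. conjugate_by (kron U U) M \<partial>distr haar_unitary haar_unitary (\<lambda>U. V ** U))"
    by (rule integral_distr[OF measurable_haar_mult(1)[OF assms] measurable_twirl_integrand, symmetric])
  also have "distr haar_unitary haar_unitary (\<lambda>U. V ** U) = haar_unitary"
    using is_haar_unitary_haar_unitary assms by (auto simp: is_haar_unitary_def)
  finally show ?thesis by (simp add: haar_twirl_def)
qed

lemma haar_twirl_right:
  assumes "V \<in> unitaries"
  shows "haar_twirl (conjugate_by (kron V V) M) = haar_twirl M"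
proof -
  have "haar_twirl (conjugate_by (kron V V) M) =
      (\<integral>U. conjugate_by (kron (U ** V) (U ** V)) M \<partial>haar_unitary)"
    by (simp add: haar_twirl_def flip: conjugate_by_mult kron_mult)
  also have "\<dots> = (\<integral>U. conjugate_by (kron U U) M \<partial>distr haar_unitary haar_unitary (\<lambda>U. U ** V))"
    by (rule integral_distr[OF measurable_haar_mult(2)[OF assms] measurable_twirl_integrand, symmetric])
  finally show ?thesis by (simp add: haar_unitary_right_invariant[OF assms] haar_twirl_def)
qed

lemma haar_twirl_invariant:
  assumes "unitarily_invariant M"
  shows "haar_twirl M = M"
proof -
  interpret prob_space "haar_unitary :: (complex^'a^'a) measure" by (rule prob_space_haar_unitary)
  have "haar_twirl M = (\<integral>U. M \<partial>(haar_unitary :: (complex^'a^'a) measure))"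
    unfolding haar_twirl_def using assms
    by (intro Bochner_Integration.integral_cong) (auto simp: space_haar_unitary unitarily_invariant_def)
  then show ?thesis by (simp add: prob_space)
qed

lemma isotropic_haar_twirl: "isotropic (haar_twirl M)"
  by (rule unitarily_invariant_imp_isotropic) (simp add: unitarily_invariant_def haar_twirl_left)

definition twirl :: "(complex^'n^'n) set \<Rightarrow>
    complex^('n \<times> 'n)^('n \<times> 'n) \<Rightarrow> complex^('n::finite \<times> 'n)^('n \<times> 'n)" where
  "twirl S M = cscale (1 / of_nat (card S)) (\<Sum>U\<in>S. conjugate_by (kron U U) M)"

lemma unitary_2_design_iff_twirl:
  "unitary_2_design S \<longleftrightarrow> finite S \<and> S \<subseteq> unitaries \<and> (\<forall>M. twirl S M = haar_twirl M)"
  by (simp add: unitary_2_design_def twirl_def haar_twirl_def)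

lemma sum_const_cscale: "(\<Sum>i\<in>I. A) = cscale (of_nat (card I)) A" for A :: "complex^'n^'m"
  by (induction I rule: infinite_finite_induct) (simp_all add: cmat.scale_left_distrib del: sum_constant)

text \<open>Right invariance absorbs each summand's conjugation. A design is thus recognised by its
  averages already being unitarily invariant.\<close>

lemma haar_twirl_twirl:
  assumes "finite S" "S \<noteq> {}" "S \<subseteq> unitaries"
  shows "haar_twirl (twirl S M) = haar_twirl M"
proof -
  have "haar_twirl (twirl S M) = cscale (1 / of_nat (card S)) (\<Sum>U\<in>S. haar_twirl M)"
    unfolding twirl_def haar_twirl_cscale haar_twirl_sum
    using assms(3) by (intro arg_cong[where f = "cscale _"] sum.cong haar_twirl_right) auto
  then show ?thesis
    using assms unfolding sum_const_cscale by simp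
qed

section \<open>The symmetry group\<close>

definition symmetries :: "(complex^'n^'n) set \<Rightarrow> (complex^'n^'n) set" where
  "symmetries B = {U \<in> unitaries. conjugate_by U ` B = B}"

lemma symmetry_group_eq: "symmetry_group B = phase_class ` symmetries B"
  by (simp add: symmetry_group_def symmetries_def)

lemma symmetries_unitaries: "U \<in> symmetries B \<Longrightarrow> U \<in> unitaries"
  by (simp add: symmetries_def)

lemma symmetries_image: "U \<in> symmetries B \<Longrightarrow> E \<in> B \<Longrightarrow> conjugate_by U E \<in> B"
  by (auto simp: symmetries_def)

lemma symmetries_mult:
  assumes "U \<in> symmetries B" "V \<in> symmetries B"
  shows "U ** V \<in> symmetries B"
proof -
  have "conjugate_by (U ** V) ` B = conjugate_by U ` conjugate_by V ` B"
    by (simp add: image_image conjugate_by_mult)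
  then show ?thesis using assms by (simp add: symmetries_def unitaries_mult)
qed

lemma one_in_symmetries: "mat 1 \<in> symmetries B"
  by (simp add: symmetries_def unitaries_one)

lemma in_phase_class: "U \<in> phase_class U"
  unfolding phase_class_def by (intro CollectI exI[of _ 1]) simp

lemma phase_class_subset: "V \<in> phase_class U \<Longrightarrow> phase_class V \<subseteq> phase_class U"
  by (auto simp: phase_class_def norm_mult)

lemma phase_class_sym:
  assumes "V \<in> phase_class U"
  shows "U \<in> phase_class V"
proof -
  obtain c where c: "cmod c = 1" "V = cscale c U" using assms by (auto simp: phase_class_def)
  then have "c \<noteq> 0" by auto
  with c have "U = cscale (inverse c) V" "cmod (inverse c) = 1" by (simp_all add: norm_inverse)
  then show ?thesis unfolding phase_class_def by blast
qed

lemma phase_class_eq_iff: "phase_class U = phase_class V \<longleftrightarrow> V \<in> phase_class U"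
proof
  assume "V \<in> phase_class U"
  then show "phase_class U = phase_class V"
    using phase_class_subset phase_class_sym by blast
qed (simp add: in_phase_class)

lemma phase_class_conjugate_by: "V \<in> phase_class U \<Longrightarrow> conjugate_by V X = conjugate_by U X"
  by (auto simp: phase_class_def conjugate_by_phase)

lemma phase_class_conjugate_by_kron:
  assumes "V \<in> phase_class U"
  shows "conjugate_by (kron V V) M = conjugate_by (kron U U) M"
proof -
  obtain c where "cmod c = 1" "V = cscale c U" using assms by (auto simp: phase_class_def)
  then show ?thesis by (simp add: kron_cscale conjugate_by_phase norm_mult)
qed

lemma phase_class_symmetries:
  assumes "U \<in> symmetries B" "V \<in> phase_class U"
  shows "V \<in> symmetries B"
proof -
  obtain c where c: "cmod c = 1" "V = cscale c U" using assms by (auto simp: phase_class_def)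
  then have "c * cnj c = 1" by (simp add: complex_norm_square[symmetric])
  then have "cnj c * c = 1" "c * cnj c = 1" by (simp_all add: mult.commute)
  then have "V \<in> unitaries" using symmetries_unitaries[OF assms(1)] c
    by (simp add: unitaries_def adjoint_mat_cscale cscale_mult_left cscale_mult_right)
  moreover have "conjugate_by V = conjugate_by U"
    using phase_class_conjugate_by[OF assms(2)] by blast
  ultimately show ?thesis using assms(1) by (simp add: symmetries_def)
qed

lemma phase_class_mult_left:
  assumes "U \<in> unitaries"
  shows "U ** W \<in> phase_class (U ** V) \<longleftrightarrow> W \<in> phase_class V"
proof -
  have cancel: "adjoint_mat U ** (U ** Z) = Z" for Z
    using assms by (simp add: matrix_mul_assoc unitaries_def)
  have "U ** W = cscale c (U ** V) \<longleftrightarrow> W = cscale c V" for c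
  proof
    assume "U ** W = cscale c (U ** V)"
    then have "adjoint_mat U ** (U ** W) = adjoint_mat U ** (U ** cscale c V)"
      by (simp add: cscale_mult_right)
    then show "W = cscale c V" by (simp only: cancel)
  qed (simp add: cscale_mult_right)
  then show ?thesis by (simp add: phase_class_def)
qed

text \<open>The second claim says that a representative is recovered from its class, so distinct
  representatives lie in distinct classes.\<close>

lemma symmetry_representative:
  assumes "\<forall>g\<in>symmetry_group B. rep g \<in> g" "U \<in> rep ` symmetry_group B"
  shows "U \<in> symmetries B" "rep (phase_class U) = U"
proof -
  obtain V where V: "V \<in> symmetries B" "U = rep (phase_class V)"
    using assms(2) by (auto simp: symmetry_group_eq)
  then have "U \<in> phase_class V" using assms(1) by (auto simp: symmetry_group_eq)
  then show "U \<in> symmetries B" "rep (phase_class U) = U"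
    using V(2) phase_class_symmetries[OF V(1)] by (simp_all flip: phase_class_eq_iff)
qed

text \<open>Left multiplication by \<open>V\<close>, followed by passing to the chosen representative, permutes the
  representatives.\<close>

lemma twirl_symmetries_invariant:
  assumes rep: "\<forall>g\<in>symmetry_group B. rep g \<in> g" and fin: "finite (symmetry_group B)"
    and V: "V \<in> symmetries B"
  shows "conjugate_by (kron V V) (twirl (rep ` symmetry_group B) M) = twirl (rep ` symmetry_group B) M"
proof -
  define S where "S = rep ` symmetry_group B"
  define p where "p U = rep (phase_class (V ** U))" for U
  note S = symmetry_representative[OF rep, folded S_def]
  have p_class: "p U \<in> phase_class (V ** U)" if "U \<in> S" for U
    using rep symmetries_mult[OF V S(1)[OF that]] by (simp add: p_def symmetry_group_eq)
  have "p ` S \<subseteq> S"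
    using symmetries_mult[OF V S(1)] by (auto simp: p_def S_def symmetry_group_eq)
  moreover have "inj_on p S"
  proof
    fix U W assume UW: "U \<in> S" "W \<in> S" "p U = p W"
    then have "phase_class (V ** U) = phase_class (V ** W)"
      using p_class by (metis phase_class_eq_iff)
    then have "phase_class U = phase_class W"
      by (simp add: phase_class_eq_iff phase_class_mult_left symmetries_unitaries[OF V])
    then show "U = W" using S(2) UW by metis
  qed
  moreover have "finite S" using fin by (simp add: S_def)
  ultimately have "bij_betw p S S"
    by (simp add: bij_betw_def endo_inj_surj)
  have "conjugate_by (kron V V) (\<Sum>U\<in>S. conjugate_by (kron U U) M) =
      (\<Sum>U\<in>S. conjugate_by (kron (V ** U) (V ** U)) M)"
    by (simp add: conjugate_by_sum flip: conjugate_by_mult kron_mult)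
  also have "\<dots> = (\<Sum>U\<in>S. conjugate_by (kron (p U) (p U)) M)"
    using p_class by (intro sum.cong refl phase_class_conjugate_by_kron[symmetric])
  also have "\<dots> = (\<Sum>U\<in>S. conjugate_by (kron U U) M)"
    by (rule sum.reindex_bij_betw) fact
  finally show ?thesis
    by (simp add: twirl_def conjugate_by_cscale flip: S_def)
qed

section \<open>Double transitivity and averages over the symmetry group\<close>

text \<open>On \<open>A\<close> the function \<open>g\<close> factors through \<open>f\<close>. Here
  \<open>f\<close> will be the action on the basis and \<open>g\<close> the phase class.\<close>

lemma finite_image_factor:
  assumes "finite (f ` A)" "\<And>x y. x \<in> A \<Longrightarrow> y \<in> A \<Longrightarrow> f x = f y \<Longrightarrow> g x = g y"
  shows "finite (g ` A)"
proof -
  have "g ` A \<subseteq> (\<lambda>z. g (SOME x. x \<in> A \<and> f x = z)) ` f ` A"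
  proof
    fix y assume "y \<in> g ` A"
    then obtain x where x: "x \<in> A" "y = g x" by blast
    let ?x = "SOME x'. x' \<in> A \<and> f x' = f x"
    have "?x \<in> A \<and> f ?x = f x"
      using x by (intro someI[of "\<lambda>x'. x' \<in> A \<and> f x' = f x" x]) simp
    then have "g ?x = y" using assms(2) x by metis
    then show "y \<in> (\<lambda>z. g (SOME x. x \<in> A \<and> f x = z)) ` f ` A"
      using x by (auto intro!: image_eqI)
  qed
  then show ?thesis using assms(1) by (meson finite_imageI finite_subset)
qed

text \<open>Covers dimension one, where two-transitivity is vacuous.\<close>

lemma isotropic_card_1:
  fixes M :: "complex^('n::finite \<times> 'n)^('n \<times> 'n)"
  assumes "CARD('n) = 1"
  shows "isotropic M"
proof -
  obtain u where u: "UNIV = {u :: 'n}" using assms by (metis card_1_singletonE)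
  have "superop M X $ i $ k = (cscale 0 X + cscale (M $ (u, u) $ (u, u) * trace X) (mat 1)) $ i $ k" for X i k
  proof -
    have "i = u" "k = u" using u by auto
    then show ?thesis by (simp add: superop_nth trace_def mat_def u)
  qed
  then have "superop M X = cscale 0 X + cscale (M $ (u, u) $ (u, u) * trace X) (mat 1)" for X
    unfolding vec_eq_iff by blast
  then show ?thesis unfolding isotropic_def by blast
qed

section \<open>Coordinates in the operator basis\<close>

context
  fixes B :: "(complex^'n^'n) set"
  assumes basis: "operator_basis B"
begin

abbreviation coord :: "complex^'n^'n \<Rightarrow> complex^'n^'n \<Rightarrow> complex" where
  "coord \<equiv> cmat.representation B"

lemma finite_basis: "finite B"
  and independent_basis: "cmat.independent B"
  and in_span_basis: "X \<in> cmat.span B"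
  using basis by (auto simp: operator_basis_def)

lemma coord_expansion: "(\<Sum>F\<in>B. cscale (coord X F) F) = X"
  by (rule cmat.sum_representation_eq[OF independent_basis in_span_basis finite_basis order_refl])

lemma coord_basis: "F \<in> B \<Longrightarrow> coord F E = (if E = F then 1 else 0)"
  by (simp add: cmat.representation_basis[OF independent_basis])

lemma coord_cscale: "coord (cscale c X) E = c * coord X E"
  by (simp add: cmat.representation_scale[OF independent_basis in_span_basis])

lemma coord_add: "coord (X + Y) E = coord X E + coord Y E"
  by (simp add: cmat.representation_add[OF independent_basis in_span_basis in_span_basis])

lemma coord_sum: "coord (\<Sum>i\<in>I. f i) E = (\<Sum>i\<in>I. coord (f i) E)"
  by (simp add: cmat.representation_sum[OF independent_basis in_span_basis])

text \<open>A symmetry permutes the basis, so it only relabels coordinates.\<close>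

lemma coord_conjugate_by:
  assumes V: "V \<in> symmetries B" and E: "E \<in> B"
  shows "coord (conjugate_by V X) (conjugate_by V E) = coord X E"
proof -
  have "conjugate_by V E = conjugate_by V F \<longleftrightarrow> F = E" for F
    using conjugate_by_inj[OF symmetries_unitaries[OF V]] by metis
  then have "coord (conjugate_by V F) (conjugate_by V E) = (if F = E then 1 else 0)" if "F \<in> B" for F
    using symmetries_image[OF V that] by (simp add: coord_basis)
  then have "coord (conjugate_by V (\<Sum>F\<in>B. cscale (coord X F) F)) (conjugate_by V E) =
      (\<Sum>F\<in>B. if F = E then coord X F else 0)"
    unfolding conjugate_by_sum conjugate_by_cscale coord_sum coord_cscale
    by (intro sum.cong refl) simp
  then show ?thesis using E finite_basis by (simp add: coord_expansion)
qed

section \<open>From the design property to double transitivity\<close>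

lemma supersymmetricI_design:
  assumes design: "projective_unitary_2_design (symmetry_group B)"
  shows "supersymmetric B"
  unfolding supersymmetric_def
proof (intro ballI impI)
  fix E F E' F' assume B: "E \<in> B" "F \<in> B" "E' \<in> B" "F' \<in> B" and neq: "E \<noteq> F" "E' \<noteq> F'"
  define rep :: "(complex^'n^'n) set \<Rightarrow> complex^'n^'n" where "rep g = (SOME U. U \<in> g)" for g
  define S where "S = rep ` symmetry_group B"
  have rep: "\<forall>g\<in>symmetry_group B. rep g \<in> g"
    unfolding rep_def symmetry_group_eq by (auto intro: someI in_phase_class)
  have S: "finite S" "S \<subseteq> unitaries" "\<And>M. twirl S M = haar_twirl M"
    using design rep by (auto simp: projective_unitary_2_design_def unitary_2_design_iff_twirl S_def)
  have S_sym: "U \<in> symmetries B" if "U \<in> S" for U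
    using symmetry_representative(1)[OF rep] that by (simp add: S_def)
  define moving where "moving P Q P' Q' = {U \<in> S. conjugate_by U P = P' \<and> conjugate_by U Q = Q'}" for P Q P' Q'
  have coord_twirl: "\<exists>M. \<forall>P'\<in>B. \<forall>Q'\<in>B.
      coord (superop (twirl S M) Q') P' = of_nat (card (moving P Q P' Q')) / of_nat (card S)"
    if PQ: "P \<in> B" "Q \<in> B" for P Q
  proof -
    \<comment> \<open>This map is the matrix unit of the basis \<open>B\<close> in position
      \<open>(P, Q)\<close>; averaging it counts where the group sends that pair.\<close>
    have "\<exists>M. \<forall>X. superop M X = cscale (coord X Q) P"
      by (rule superop_surj) (simp_all add: coord_add coord_cscale cmat.scale_left_distrib)
    then obtain M where M: "\<And>X. superop M X = cscale (coord X Q) P" by blast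
    have "coord (superop (twirl S M) Q') P' = of_nat (card (moving P Q P' Q')) / of_nat (card S)"
      if P': "P' \<in> B" "Q' \<in> B" for P' Q'
    proof -
      have "coord (superop (conjugate_by (kron U U) M) Q') P' = (if U \<in> moving P Q P' Q' then 1 else 0)"
        if U: "U \<in> S" for U
      proof -
        \<comment> \<open>Undoing \<open>U\<close> on the argument amounts to testing whether
          \<open>U\<close> takes \<open>Q\<close> to \<open>Q'\<close>.\<close>
        have "coord (conjugate_by (adjoint_mat U) Q') Q = coord Q' (conjugate_by U Q)"
          using coord_conjugate_by[OF S_sym[OF U] PQ(2), of "conjugate_by (adjoint_mat U) Q'"]
          by (simp add: conjugate_by_adjoint_cancel symmetries_unitaries[OF S_sym[OF U]])
        then show ?thesis
          using U PQ P' symmetries_image[OF S_sym[OF U]]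
          by (auto simp: superop_conjugate M conjugate_by_cscale coord_cscale coord_basis moving_def)
      qed
      then have "(\<Sum>U\<in>S. coord (superop (conjugate_by (kron U U) M) Q') P') =
          (\<Sum>U\<in>S. if U \<in> moving P Q P' Q' then 1 else 0)"
        by (intro sum.cong) auto
      also have "\<dots> = of_nat (card (moving P Q P' Q'))"
        using S(1) by (simp add: moving_def sum.If_cases Int_def cong: conj_cong)
      finally show ?thesis
        by (simp add: twirl_def superop_cscale_left superop_sum_left coord_cscale coord_sum)
    qed
    then show ?thesis by blast
  qed
  \<comment> \<open>Only the scalar \<open>b\<close> depends on the starting pair
    \<open>(P, Q)\<close>; the other factor depends on the target pair alone. This is what makes the
    supports of different orbits comparable.\<close>
  have offdiag: "\<exists>b. \<forall>P'\<in>B. \<forall>Q'\<in>B. P' \<noteq> Q' \<longrightarrow>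
      (moving P Q P' Q' \<noteq> {} \<longleftrightarrow> b * (trace Q' * coord (mat 1) P') \<noteq> 0)"
    if PQ: "P \<in> B" "Q \<in> B" for P Q
  proof -
    obtain M where M: "\<And>P' Q'. P' \<in> B \<Longrightarrow> Q' \<in> B \<Longrightarrow>
        coord (superop (twirl S M) Q') P' = of_nat (card (moving P Q P' Q')) / of_nat (card S)"
      using coord_twirl[OF PQ] by blast
    obtain a b where ab: "\<And>X. superop (twirl S M) X = cscale a X + cscale (b * trace X) (mat 1)"
      using isotropic_haar_twirl[of M] by (auto simp: S(3) isotropic_def)
    have "moving P Q P' Q' \<noteq> {} \<longleftrightarrow> b * (trace Q' * coord (mat 1) P') \<noteq> 0"
      if "P' \<in> B" "Q' \<in> B" "P' \<noteq> Q'" for P' Q'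
    proof -
      have "finite (moving P Q P' Q')" "moving P Q P' Q' \<subseteq> S" using S(1) by (auto simp: moving_def)
      then have "moving P Q P' Q' \<noteq> {} \<longleftrightarrow> coord (superop (twirl S M) Q') P' \<noteq> 0"
        using S(1) that by (auto simp: M)
      also have "coord (superop (twirl S M) Q') P' = b * (trace Q' * coord (mat 1) P')"
        using that by (simp add: ab coord_add coord_cscale coord_basis)
      finally show ?thesis .
    qed
    then show ?thesis by blast
  qed
  have refl: "moving P Q P Q \<noteq> {}" for P Q
  proof -
    let ?U = "rep (phase_class (mat 1))"
    have g: "phase_class (mat 1) \<in> symmetry_group B"
      by (simp add: symmetry_group_eq one_in_symmetries)
    then have "?U \<in> phase_class (mat 1)" using rep by blast
    then have "?U \<in> moving P Q P Q" using g by (simp add: moving_def S_def phase_class_conjugate_by)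
    then show ?thesis by blast
  qed
  obtain b where b: "\<And>P' Q'. P' \<in> B \<Longrightarrow> Q' \<in> B \<Longrightarrow> P' \<noteq> Q' \<Longrightarrow>
      (moving E F P' Q' \<noteq> {} \<longleftrightarrow> b * (trace Q' * coord (mat 1) P') \<noteq> 0)"
    using offdiag[OF B(1,2)] by blast
  obtain b' where b': "\<And>P' Q'. P' \<in> B \<Longrightarrow> Q' \<in> B \<Longrightarrow> P' \<noteq> Q' \<Longrightarrow>
      (moving E' F' P' Q' \<noteq> {} \<longleftrightarrow> b' * (trace Q' * coord (mat 1) P') \<noteq> 0)"
    using offdiag[OF B(3,4)] by blast
  \<comment> \<open>That \<open>(E, F)\<close> reaches itself gives \<open>b \<noteq> 0\<close>;
    that \<open>(E', F')\<close> reaches itself makes the target factor nonzero there. Their product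
    is the required entry.\<close>
  have "moving E F E' F' \<noteq> {}"
    using b[OF B(1,2) neq(1)] b[OF B(3,4) neq(2)] b'[OF B(3,4) neq(2)] refl by simp
  then obtain U where U: "U \<in> S" "conjugate_by U E = E'" "conjugate_by U F = F'"
    by (auto simp: moving_def)
  then show "\<exists>g\<in>symmetry_group B. \<forall>U\<in>g. conjugate_by U E = E' \<and> conjugate_by U F = F'"
    using S_sym[OF U(1)]
    by (intro bexI[of _ "phase_class U"]) (auto simp: phase_class_conjugate_by symmetry_group_eq)
qed

section \<open>From double transitivity to the design property\<close>

lemma supersymmetric_symmetry:
  assumes "supersymmetric B" "E \<in> B" "F \<in> B" "E' \<in> B" "F' \<in> B" "E \<noteq> F" "E' \<noteq> F'"
  obtains V where "V \<in> symmetries B" "conjugate_by V E = E'" "conjugate_by V F = F'"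
proof -
  obtain g where "g \<in> symmetry_group B" "\<forall>U\<in>g. conjugate_by U E = E' \<and> conjugate_by U F = F'"
    using assms unfolding supersymmetric_def by metis
  then show ?thesis using that in_phase_class by (auto simp: symmetry_group_eq)
qed

text \<open>Faithfulness of the action: since \<open>B\<close> spans, the product of the adjoint of
  \<open>U\<close> with \<open>V\<close> commutes with every operator, hence is scalar, and
  unitarity makes the scalar a phase.\<close>

lemma phase_class_eq_if_conjugate_by_eq:
  assumes U: "U \<in> unitaries" and V: "V \<in> unitaries"
    and eq: "\<And>F. F \<in> B \<Longrightarrow> conjugate_by U F = conjugate_by V F"
  shows "phase_class U = phase_class V"
proof -
  define W where "W = adjoint_mat U ** V"
  have W: "W \<in> unitaries" using U V by (simp add: W_def unitaries_mult unitaries_adjoint)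
  have "conjugate_by U (\<Sum>F\<in>B. cscale (coord X F) F) = conjugate_by V (\<Sum>F\<in>B. cscale (coord X F) F)" for X
    unfolding conjugate_by_sum conjugate_by_cscale by (intro sum.cong) (simp_all add: eq)
  then have UV: "conjugate_by U X = conjugate_by V X" for X
    by (simp add: coord_expansion)
  have "conjugate_by W X = X" for X
    by (simp add: W_def conjugate_by_mult conjugate_by_adjoint_cancel U flip: UV)
  then have "W ** X ** adjoint_mat W ** W = X ** W" for X
    by (simp add: conjugate_by_def)
  then have "X ** W = W ** X" for X
    using W by (simp add: unitaries_def flip: matrix_mul_assoc)
  then obtain c where c: "W = cscale c (mat 1)" using commutes_imp_scalar by blast
  have "adjoint_mat W ** W = cscale (c * cnj c) (mat 1)"
    by (simp add: c adjoint_mat_cscale cscale_mult_left cscale_mult_right)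
  then have "mat 1 = cscale (c * cnj c) (mat 1 :: complex^'n^'n)"
    using W by (simp add: unitaries_def)
  from arg_cong[OF this, of "\<lambda>Z. Z $ undefined $ undefined"]
  have "c * cnj c = 1" by (simp add: mat_def)
  then have "of_real ((cmod c)\<^sup>2) = (1 :: complex)" by (simp only: complex_norm_square)
  then have "(cmod c)\<^sup>2 = 1" using of_real_eq_1_iff by blast
  then have "cmod c = 1" using power2_eq_imp_eq[of "cmod c" 1] by simp
  have "V = U ** W" using U by (simp add: W_def matrix_mul_assoc unitaries_def)
  also have "\<dots> = cscale c U" by (simp add: c cscale_mult_right)
  finally have "V \<in> phase_class U" using \<open>cmod c = 1\<close> unfolding phase_class_def by blast
  then show ?thesis unfolding phase_class_eq_iff .
qed

text \<open>A class is determined by its action on the finite set \<open>B\<close>. Restricting the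
  action to \<open>B\<close> places it in the finite set of extensional functions from
  \<open>B\<close> to \<open>B\<close>.\<close>

lemma finite_symmetry_group: "finite (symmetry_group B)"
  unfolding symmetry_group_eq
proof (rule finite_image_factor)
  have "(\<lambda>U. restrict (conjugate_by U) B) ` symmetries B \<subseteq> B \<rightarrow>\<^sub>E B"
    using symmetries_image by fastforce
  then show "finite ((\<lambda>U. restrict (conjugate_by U) B) ` symmetries B)"
    by (rule finite_subset) (simp add: finite_PiE finite_basis)
next
  fix U V assume UV: "U \<in> symmetries B" "V \<in> symmetries B" "restrict (conjugate_by U) B = restrict (conjugate_by V) B"
  have "conjugate_by U F = conjugate_by V F" if "F \<in> B" for F
    using fun_cong[OF UV(3), of F] that by simp
  then show "phase_class U = phase_class V"
    by (rule phase_class_eq_if_conjugate_by_eq[OF UV(1,2)[THEN symmetries_unitaries]])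
qed

text \<open>In the basis \<open>B\<close> an invariant map has a constant diagonal and a constant off-diagonal part.\<close>

lemma supersymmetric_invariant_form:
  assumes sup: "supersymmetric B"
    and inv: "\<And>V. V \<in> symmetries B \<Longrightarrow> conjugate_by (kron V V) T = T"
  shows "\<exists>a b. \<forall>X. superop T X = cscale a X + cscale (b * (\<Sum>F\<in>B. coord X F)) (\<Sum>B)"
proof -
  \<comment> \<open>This is the matrix of the map in the basis \<open>B\<close>; invariance makes it
    constant on orbits of ordered pairs.\<close>
  define m where "m E F = coord (superop T F) E" for E F
  have m_conj: "m (conjugate_by V E) (conjugate_by V F) = m E F" if V: "V \<in> symmetries B" and "E \<in> B" for V E F
    unfolding m_def superop_conjugate_invariant[OF inv[OF V] symmetries_unitaries[OF V]]
    by (rule coord_conjugate_by) fact+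
  have off_eq: "m E F = m E' F'"
    if E: "E \<in> B" "F \<in> B" "E' \<in> B" "F' \<in> B" "E \<noteq> F" "E' \<noteq> F'" for E F E' F'
  proof -
    obtain V where "V \<in> symmetries B" "conjugate_by V E = E'" "conjugate_by V F = F'"
      by (rule supersymmetric_symmetry[OF sup E])
    then show ?thesis using m_conj[of V E F] E(1) by simp
  qed
  \<comment> \<open>Double transitivity speaks of distinct pairs only, so a symmetry taking
    \<open>(E, E')\<close> to \<open>(E', E)\<close> is used to compare diagonal entries.\<close>
  have diag_eq: "m E E = m E' E'" if E: "E \<in> B" "E' \<in> B" for E E'
  proof (cases "E = E'")
    case False
    obtain V where "V \<in> symmetries B" "conjugate_by V E = E'"
      by (rule supersymmetric_symmetry[OF sup E E(2,1) False False[symmetric]])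
    then show ?thesis using m_conj[of V E E] E by simp
  qed simp
  have "\<exists>b. \<forall>E\<in>B. \<forall>F\<in>B. E \<noteq> F \<longrightarrow> m E F = b"
  proof (cases "\<exists>E\<in>B. \<exists>F\<in>B. E \<noteq> F")
    case True
    then obtain E F where EF: "E \<in> B" "F \<in> B" "E \<noteq> F" by blast
    have "\<forall>E'\<in>B. \<forall>F'\<in>B. E' \<noteq> F' \<longrightarrow> m E' F' = m E F"
      by (intro ballI impI) (rule off_eq[OF _ _ EF(1,2) _ EF(3)])
    then show ?thesis ..
  next
    case False
    then have "\<forall>E\<in>B. \<forall>F\<in>B. E \<noteq> F \<longrightarrow> m E F = 0" by metis
    then show ?thesis ..
  qed
  then obtain b where b: "\<forall>E\<in>B. \<forall>F\<in>B. E \<noteq> F \<longrightarrow> m E F = b" ..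
  have "\<exists>c. \<forall>E\<in>B. m E E = c"
  proof (cases "B = {}")
    case False
    then obtain E where E: "E \<in> B" by blast
    have "\<forall>E'\<in>B. m E' E' = m E E"
      by (intro ballI) (rule diag_eq[OF _ E])
    then show ?thesis ..
  qed simp
  then obtain c where c: "\<forall>E\<in>B. m E E = c" ..
  \<comment> \<open>Column \<open>F\<close> has \<open>c\<close> on the diagonal and
    \<open>b\<close> elsewhere; writing \<open>b\<close> everywhere leaves the excess
    \<open>c - b\<close> at \<open>F\<close>.\<close>
  have basis_image: "superop T F = cscale (c - b) F + cscale b (\<Sum>B)" if F: "F \<in> B" for F
  proof -
    have "superop T F = (\<Sum>E\<in>B. cscale (m E F) E)"
      by (simp add: m_def coord_expansion)
    also have "\<dots> = (\<Sum>E\<in>B. (if E = F then cscale (c - b) E else 0) + cscale b E)"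
      using F b c by (intro sum.cong refl) (auto simp: cmat.scale_left_diff_distrib)
    also have "\<dots> = cscale (c - b) F + cscale b (\<Sum>B)"
      using F finite_basis by (simp add: sum.distrib cmat.scale_sum_right)
    finally show ?thesis .
  qed
  have "superop T X = cscale (c - b) X + cscale (b * (\<Sum>F\<in>B. coord X F)) (\<Sum>B)" for X
  proof -
    have "superop T X = superop T (\<Sum>F\<in>B. cscale (coord X F) F)"
      by (simp add: coord_expansion)
    also have "\<dots> = (\<Sum>F\<in>B. cscale (coord X F) (cscale (c - b) F + cscale b (\<Sum>B)))"
      by (simp add: superop_sum superop_cscale basis_image)
    also have "\<dots> = (\<Sum>F\<in>B. cscale (c - b) (cscale (coord X F) F) + cscale (b * coord X F) (\<Sum>B))"
      by (simp add: cmat.scale_right_distrib mult.commute)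
    also have "\<dots> = cscale (c - b) (\<Sum>F\<in>B. cscale (coord X F) F) + cscale (\<Sum>F\<in>B. b * coord X F) (\<Sum>B)"
      unfolding sum.distrib cmat.scale_sum_right[symmetric] cmat.scale_sum_left[symmetric] ..
    finally show ?thesis
      by (simp add: coord_expansion sum_distrib_left)
  qed
  then show ?thesis by blast
qed

text \<open>
  The map \<open>X \<mapsto> tr(X) 1\<close> is itself invariant, which expresses the off-diagonal part through it and the
  identity.
\<close>

lemma supersymmetric_invariant_imp_isotropic:
  assumes sup: "supersymmetric B"
    and inv: "\<And>V. V \<in> symmetries B \<Longrightarrow> conjugate_by (kron V V) T = T"
  shows "isotropic T"
proof (cases "CARD('n) = 1")
  case False
  define \<sigma> where "\<sigma> X = (\<Sum>F\<in>B. coord X F)" for X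
  obtain a b where T: "\<And>X. superop T X = cscale a X + cscale (b * \<sigma> X) (\<Sum>B)"
    using supersymmetric_invariant_form[OF sup inv] unfolding \<sigma>_def by blast
  have "isotropic (mat 1 :: complex^('n \<times> 'n)^('n \<times> 'n))"
    unfolding isotropic_def superop_one by (intro exI[of _ 0] exI[of _ 1]) simp
  then have "unitarily_invariant (mat 1 :: complex^('n \<times> 'n)^('n \<times> 'n))"
    by (rule isotropic_imp_unitarily_invariant)
  then have "conjugate_by (kron V V) (mat 1) = mat 1" if "V \<in> symmetries B" for V
    using symmetries_unitaries[OF that] by (simp add: unitarily_invariant_def)
  then obtain a0 b0 where one: "\<And>X. cscale (trace X) (mat 1) = cscale a0 X + cscale (b0 * \<sigma> X) (\<Sum>B)"
    using supersymmetric_invariant_form[OF sup, of "mat 1"] unfolding superop_one \<sigma>_def by blast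
  \<comment> \<open>Otherwise the trace map would be a multiple of the identity map: a traceless
    \<open>munit i j\<close> gives \<open>a0 = 0\<close>, and then the trace map would vanish at
    \<open>mat 1\<close>. Dimension at least two provides \<open>i \<noteq> j\<close>.\<close>
  have "b0 \<noteq> 0"
  proof
    assume b0: "b0 = 0"
    have "\<not> (\<forall>i j :: 'n. i = j)"
    proof
      assume all: "\<forall>i j :: 'n. i = j"
      have "i \<in> {undefined}" for i :: 'n
        by (rule singleton_iff[THEN iffD2]) (rule all[rule_format])
      then have "card (UNIV :: 'n set) \<le> card {undefined :: 'n}"
        by (intro card_mono) auto
      then show False using False zero_less_card_finite[where 'a = 'n] by simp
    qed
    then obtain i j :: 'n where ij: "i \<noteq> j" by blast
    have "trace (munit i j :: complex^'n^'n) = 0"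
      using ij by (auto simp: trace_def munit_nth intro!: sum.neutral)
    then have "a0 = 0"
      using arg_cong[OF one[of "munit i j"], of "\<lambda>Z. Z $ i $ j"] ij by (simp add: b0 munit_nth)
    then show False
      using arg_cong[OF one[of "mat 1"], of "\<lambda>Z. Z $ i $ i"] by (simp add: b0 mat_def trace_def)
  qed
  \<comment> \<open>Solving \<open>one\<close> for the term with \<open>\<sigma> X\<close>
    eliminates it from the formula for \<open>T\<close>.\<close>
  have "superop T X = cscale (a - b / b0 * a0) X + cscale (b / b0 * trace X) (mat 1)" for X
  proof -
    have "cscale (b * \<sigma> X) (\<Sum>B) = cscale (b / b0) (cscale (b0 * \<sigma> X) (\<Sum>B))"
      using \<open>b0 \<noteq> 0\<close> by simp
    also have "cscale (b0 * \<sigma> X) (\<Sum>B) = cscale (trace X) (mat 1) - cscale a0 X"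
      by (simp add: one)
    finally show ?thesis
      unfolding T by (simp add: cmat.scale_right_diff_distrib cmat.scale_left_diff_distrib)
  qed
  then show ?thesis unfolding isotropic_def by blast
qed (rule isotropic_card_1)

text \<open>The group average is isotropic, so the Haar average fixes it; the Haar average also
  absorbs the group average, so the two coincide.\<close>

lemma supersymmetric_imp_design:
  assumes sup: "supersymmetric B"
  shows "projective_unitary_2_design (symmetry_group B)"
  unfolding projective_unitary_2_design_def
proof (intro allI impI)
  fix rep :: "(complex^'n^'n) set \<Rightarrow> complex^'n^'n"
  assume rep: "\<forall>g\<in>symmetry_group B. rep g \<in> g"
  let ?S = "rep ` symmetry_group B"
  have S: "finite ?S" "?S \<noteq> {}" "?S \<subseteq> unitaries"
  proof -
    show "finite ?S" using finite_symmetry_group by simp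
    show "?S \<noteq> {}" using one_in_symmetries[of B] by (auto simp: symmetry_group_eq)
    show "?S \<subseteq> unitaries" using symmetry_representative(1)[OF rep] symmetries_unitaries by blast
  qed
  have "twirl ?S M = haar_twirl M" for M
  proof -
    have "isotropic (twirl ?S M)"
      by (rule supersymmetric_invariant_imp_isotropic[OF sup])
         (rule twirl_symmetries_invariant[OF rep finite_symmetry_group])
    then have "haar_twirl (twirl ?S M) = twirl ?S M"
      by (intro haar_twirl_invariant isotropic_imp_unitarily_invariant)
    then show ?thesis by (simp add: haar_twirl_twirl[OF S])
  qed
  then show "unitary_2_design ?S"
    using S by (simp add: unitary_2_design_iff_twirl)
qed

end

theorem theorem1:
  fixes B :: "(complex^'n^'n) set"
  assumes "operator_basis B"
  shows "supersymmetric B \<longleftrightarrow> projective_unitary_2_design (symmetry_group B)"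
  using supersymmetric_imp_design[OF assms] supersymmetricI_design[OF assms] by blast

end
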